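(* Suppose that $n,p\to\infty$ with $p/n\to\phi\in(0,\infty)$. Let $\mathcal K_n$ be the grid of subsample sizes of the cross-validation procedure described in the context, and for $k\in\mathcal K_n$ let $\mathcal I_k$ be the set of subsets of $\mathcal S_{\mathrm{tr}}$ of size $k$ according to the sampling scheme (subagging with or without replacement, or splagging without replacement). Suppose that for any $k\in\mathcal K_n$, as $n,k,p\to\infty$ and $p/k\to\phi_s\in[\phi,\infty)$, there exists a deterministic function $\mathscr R:(0,\infty]^2\to[0,\infty]$ such that: (i) for any $I\in\mathcal I_k$ and $\{I_{k,1},I_{k,2}\}$ a simple random sample from $\mathcal I_k$, $$R(\widetilde f_1;\mathcal D_n,\{I\})\xrightarrow{a.s.}\mathscr R(\phi_s,\phi_s),\qquad R(\widetilde f_2;\mathcal D_n,\{I_{k,1},I_{k,2}\})\xrightarrow{a.s.}\mathscr R(\phi,\phi_s);$$ (ii) for any $\phi\in(0,\infty)$, $\phi_s\mapsto\mathscr R(\phi,\phi_s)$ is proper and lower semi-continuous over $[\phi,\infty]$, and is continuous on the set $\operatorname{argmin}_{\{\psi:\psi\ge\phi\}}\mathscr R(\phi,\psi)$. Let $\widehat f^{\mathrm{cv}}_M$ be the cross-validated predictor with base predictor $\widehat f$, and suppose the estimated risk $\widehat R(\widetilde f_{M,k})$ is uniformly (in $k\in\mathcal K_n$) close to the subsample conditional risk $R(\widetilde f_{M,k};\mathcal D_n,\{I_{k,\ell}\}_{\ell=1}^M)$ with probability converging to 1. Then, for subagging with or without replacement, or splagging without replacement, for all $M\in\mathbb N$,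 $$\Big(R(\widehat f^{\mathrm{cv}}_M;\mathcal D_n,\{I_{\widehat k,\ell}\}_{\ell=1}^M)-\min_{\phi_s\ge\phi}\mathscr R_M(\phi,\phi_s)\Big)_+\xrightarrow{p}0,$$ where $$\mathscr R_M(\phi,\phi_s)=(2\mathscr R(\phi,\phi_s)-\mathscr R(\phi_s,\phi_s))+\frac2M(\mathscr R(\phi_s,\phi_s)-\mathscr R(\phi,\phi_s)).$$ Furthermore, if for any $\phi_s\in(0,\infty)$ the map $\phi\mapsto\mathscr R(\phi,\phi_s)$ is non-decreasing over $(0,\phi_s]$, then $\phi\mapsto\min_{\phi_s\ge\phi}\mathscr R_M(\phi,\phi_s)$ is monotonically increasing (i.e. non-decreasing) for every $M$.
   Context: Data $\mathcal D_n=\{(x_i,y_i)\}_{i=1}^n\subset\mathbb R^p\times\mathbb R$, i.i.d. from $P$; a base prediction procedure $\widehat f$ maps $x\in\mathbb R^p$ and a dataset to a real number; $\mathcal D_I=\{(x_j,y_j):j\in I\}$. Cross-validation procedure. Inputs: $\mathcal D_n$, a number $n_{\mathrm{te}}<n$ of test samples, $\widehat f$, $\nu\in(0,1)$, $M\in\mathbb N$, a centering choice (AVG or MOM), and a real $\eta$ if MOM. 1. Randomly split $\{1,\dots,n\}$ into $\mathcal S_{\mathrm{te}}$ with $|\mathcal S_{\mathrm{te}}|=n_{\mathrm{te}}$ and $\mathcal S_{\mathrm{tr}}$ its complement. 2. $k_0=\lfloor n^\nu\rfloor$, $\mathcal K_n=\{k_0,2k_0,\dots,\lfloor n/k_0\rfloor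 k_0\}$. 3. For $k\in\mathcal K_n$ let $\widetilde f_{M,k}(\cdot)=\frac1M\sum_{\ell=1}^M\widehat f(\cdot;\mathcal D_{I_{k,\ell}})$, where for subagging $I_{k,1},\dots,I_{k,M}$ is a simple random sample with or without replacement from all size-$k$ subsets of $\mathcal S_{\mathrm{tr}}$, and for splagging it is a simple random sample without replacement from a random split of $\mathcal S_{\mathrm{tr}}$ into $\lfloor n/k\rfloor$ parts of $k$ elements each (with $\widetilde f_{M,k}=\widetilde f_{\min\{M,\lfloor n/k\rfloor\},k}$). 4. Estimate the risk by $\widehat R(\widetilde f_{M,k})=|\mathcal S_{\mathrm{te}}|^{-1}\sum_{j\in\mathcal S_{\mathrm{te}}}(y_j-\widetilde f_{M,k}(x_j))^2$ (AVG), or the median of $B=\lceil8\log(1/\eta)\rceil$ such averages over $B$ random splits of the test set (MOM). 5. $\widehat k\in\operatorname{argmin}_{k\in\mathcal K_n}\widehat R(\widetilde f_{M,k})$. Output $\widehat f^{\mathrm{cv}}_M=\widetilde f_{M,\widehat k}$. $\widetilde f_M$ denotes the bagged predictor with $M$ bags of size $k$. The subsample conditional risk is $R(\widetilde f_M;\mathcal D_n,\{I_\ell\}_{\ell=1}^M)=\int\big(y-\frac1M\sum_{\ell}\widehat f(x;\mathcal D_{I_\ell})\big)^2dP(x,y)$. "Uniformly close with probability converging to 1" means that either $\max_{k\in\mathcal K_n}|\widehat R(\widetilde f_{M,k})-R(\widetilde f_{M,k};\mathcal D_n,\{I_{k,\ell}\})|=o_p(1)$ or $\max_{k\in\mathcal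 K_n}|\widehat R(\widetilde f_{M,k})/R(\widetilde f_{M,k};\mathcal D_n,\{I_{k,\ell}\})-1|=o_p(1)$. $(a)_+=\max(a,0)$.
   Formalization: The min is an infimum over φ ≤ φ_s < ∞ (equal to that over [φ,∞] if R(φ,·) and ψ↦R(ψ,ψ) are continuous at ∞); for splagging, M in R_M becomes min{M,⌊φ_s/φ⌋}; n_te/n→0 is assumed, grid sizes k > n−n_te are dropped, and splagging uses ⌊(n−n_te)/k⌋ parts. *)

theory Defs
  imports "HOL-Probability.Probability"
begin

text \<open>
  An observation is a pair of a feature vector in $R^p$ (an extensional function on
  \<open>{..<p}\<close>) and a response.  Indices of observations start at 0, so that a dataset of size
  \<open>n\<close> is a function \<open>d\<close> of which only the values on \<open>{..<n}\<close> matter.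
\<close>

type_synonym obs = "(nat \<Rightarrow> real) \<times> real"

definition feature_space :: "nat \<Rightarrow> (nat \<Rightarrow> real) measure" where
  "feature_space p = PiM {..<p} (\<lambda>_. borel)"

definition obs_space :: "nat \<Rightarrow> obs measure" where
  "obs_space p = feature_space p \<Otimes>\<^sub>M borel"

text \<open>
  The dataset $D_I$ is a multiset: repeated observations count, their order does not.
\<close>

definition subdata :: "(nat \<Rightarrow> obs) \<Rightarrow> nat set \<Rightarrow> obs multiset" where
  "subdata d I = image_mset d (mset_set I)"

type_synonym predictor = "(nat \<Rightarrow> real) \<Rightarrow> real"
type_synonym procedure = "(nat \<Rightarrow> real) \<Rightarrow> obs multiset \<Rightarrow> real"

definition bagged :: "procedure \<Rightarrow> (nat \<Rightarrow> obs) \<Rightarrow> nat \<Rightarrow> (nat \<Rightarrow> nat set) \<Rightarrow> predictor" where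
  "bagged f d m J x = (\<Sum>l<m. f x (subdata d (J l))) / real m"

text \<open>
  The subsample conditional risk of the predictor with bags \<open>J 0, \<dots>, J (m - 1)\<close>.  It is an
  integral of a nonnegative function and may be infinite.
\<close>

definition sub_risk ::
  "obs measure \<Rightarrow> procedure \<Rightarrow> (nat \<Rightarrow> obs) \<Rightarrow> nat \<Rightarrow> (nat \<Rightarrow> nat set) \<Rightarrow> ereal" where
  "sub_risk P f d m J =
     enn2ereal (\<integral>\<^sup>+ (x, y). ennreal ((y - bagged f d m J x)\<^sup>2) \<partial>P)"

text \<open>
  The grid consists of the $j k_0$ with $1 \le j \le \lfloor n / k_0 \rfloor$, where
  $k_0 = \lfloor n^\nu \rfloor$.  Sizes exceeding the number \<open>n - t\<close> of training observations
  are left out: the training set has no subset of such a size.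
\<close>

definition grid :: "real \<Rightarrow> nat \<Rightarrow> nat \<Rightarrow> nat set" where
  "grid \<nu> n t =
     (let k0 = nat \<lfloor>real n powr \<nu>\<rfloor> in {j * k0 | j. 1 \<le> j \<and> j \<le> n div k0 \<and> j * k0 \<le> n - t})"

datatype sampling = Subag_with_repl | Subag_without_repl | Splag

text \<open>
  The splits of the training set \<open>S\<close> into as many disjoint parts of size \<open>k\<close> as it can
  accommodate, the remaining observations being discarded.  Whenever $\lfloor n/k \rfloor$
  parts of size \<open>k\<close> fit into the training set, their number \<open>card S div k\<close>
  is $\lfloor n/k \rfloor$.
\<close>

definition splits_into_parts :: "nat set \<Rightarrow> nat \<Rightarrow> nat set set set" where
  "splits_into_parts S k =
     {Q. (\<forall>I\<in>Q. I \<subseteq> S \<and> card I = k) \<and> pairwise disjnt Q \<and> card Q = card S div k}"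

definition pool_law :: "sampling \<Rightarrow> nat set \<Rightarrow> nat \<Rightarrow> nat set set pmf" where
  "pool_law s S k =
     (case s of
        Splag \<Rightarrow> pmf_of_set (splits_into_parts S k)
      | _ \<Rightarrow> return_pmf {I. I \<subseteq> S \<and> card I = k})"

text \<open>
  The number of bags when \<open>M\<close> are asked for and the training set has \<open>r\<close> elements.  A sample
  without replacement cannot be larger than the pool it is drawn from; for splagging this is
  the convention that $M$ bags stand for $\min\{M, \lfloor n/k \rfloor\}$ bags.
\<close>

definition num_bags :: "sampling \<Rightarrow> nat \<Rightarrow> nat \<Rightarrow> nat \<Rightarrow> nat" where
  "num_bags s r k M =
     (case s of
        Subag_with_repl \<Rightarrow> M
      | Subag_without_repl \<Rightarrow> min M (r choose k)
      | Splag \<Rightarrow> min M (r div k))"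

definition samples :: "sampling \<Rightarrow> 'i set \<Rightarrow> nat \<Rightarrow> (nat \<Rightarrow> 'i) set" where
  "samples s Q m =
     (case s of
        Subag_with_repl \<Rightarrow> {..<m} \<rightarrow>\<^sub>E Q
      | _ \<Rightarrow> {J \<in> {..<m} \<rightarrow>\<^sub>E Q. inj_on J {..<m}})"

definition test_set_law :: "nat \<Rightarrow> nat \<Rightarrow> nat set pmf" where
  "test_set_law n t = pmf_of_set {S. S \<subseteq> {..<n} \<and> card S = t}"

text \<open>
  The joint law of the test set, of the pool of subsets of the training set, and of a simple
  random sample of \<open>M\<close> bags from the pool.
\<close>

definition bags_law ::
  "sampling \<Rightarrow> nat \<Rightarrow> nat \<Rightarrow> nat \<Rightarrow> nat \<Rightarrow> (nat set \<times> nat set set \<times> (nat \<Rightarrow> nat set)) pmf" where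
  "bags_law s n t k M = do {
     S \<leftarrow> test_set_law n t;
     Q \<leftarrow> pool_law s ({..<n} - S) k;
     J \<leftarrow> pmf_of_set (samples s Q (num_bags s (n - t) k M));
     return_pmf (S, Q, J)
   }"

text \<open>
  Random splits of the test set into \<open>B\<close> blocks of (almost) equal sizes.
\<close>

definition block_splits :: "nat set \<Rightarrow> nat \<Rightarrow> (nat \<Rightarrow> nat set) set" where
  "block_splits S B =
     {T \<in> {..<B} \<rightarrow>\<^sub>E Pow S. disjoint_family_on T {..<B} \<and> (\<Union>b<B. T b) = S
        \<and> (\<forall>b<B. \<forall>c<B. card (T b) \<le> card (T c) + 1)}"

definition blocks_law :: "nat \<Rightarrow> nat \<Rightarrow> nat \<Rightarrow> (nat set \<times> (nat \<Rightarrow> nat set)) pmf" where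
  "blocks_law n t B = do {
     S \<leftarrow> test_set_law n t;
     T \<leftarrow> pmf_of_set (block_splits S B);
     return_pmf (S, T)
   }"

text \<open>
  Values off the support are excluded as well, not just with probability 0.
\<close>

definition has_law :: "'b measure \<Rightarrow> ('b \<Rightarrow> 'c) \<Rightarrow> 'c pmf \<Rightarrow> bool" where
  "has_law A X q \<longleftrightarrow>
     X \<in> A \<rightarrow>\<^sub>M count_space UNIV \<and> (\<forall>w\<in>space A. X w \<in> set_pmf q)
     \<and> distr A (count_space UNIV) X = measure_pmf q"

datatype centering = AVG | MOM

definition mom_blocks :: "real \<Rightarrow> nat" where
  "mom_blocks \<eta> = nat \<lceil>8 * ln (1 / \<eta>)\<rceil>"

definition median :: "real list \<Rightarrow> real" where
  "median xs = (let ys = sort xs; m = length xs in (ys ! ((m - 1) div 2) + ys ! (m div 2)) / 2)"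

definition avg_err :: "(nat \<Rightarrow> obs) \<Rightarrow> predictor \<Rightarrow> nat set \<Rightarrow> real" where
  "avg_err d f S = (\<Sum>j\<in>S. (snd (d j) - f (fst (d j)))\<^sup>2) / real (card S)"

text \<open>
  The estimated risk on the test set \<open>S\<close>; \<open>T\<close> is a split of \<open>S\<close> into \<open>B\<close> blocks.
\<close>

definition est_risk ::
  "centering \<Rightarrow> nat \<Rightarrow> (nat \<Rightarrow> obs) \<Rightarrow> predictor \<Rightarrow> nat set \<Rightarrow> (nat \<Rightarrow> nat set) \<Rightarrow> real" where
  "est_risk c B d f S T =
     (case c of AVG \<Rightarrow> avg_err d f S | MOM \<Rightarrow> median (map (\<lambda>b. avg_err d f (T b)) [0..<B]))"

definition conv0_in_prob :: "'c measure \<Rightarrow> (nat \<Rightarrow> 'c \<Rightarrow> ereal) \<Rightarrow> bool" where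
  "conv0_in_prob N X \<longleftrightarrow>
     (\<forall>\<^sub>F n in sequentially. X n \<in> borel_measurable N)
     \<and> (\<forall>\<epsilon>>0. (\<lambda>n. measure N {v \<in> space N. \<bar>X n v\<bar> > ereal \<epsilon>}) \<longlonglongrightarrow> 0)"

text \<open>
  $(a - b)_+$, which is 0 for $a = b = \infty$.
\<close>

definition pos_diff :: "ereal \<Rightarrow> ereal \<Rightarrow> ereal" where
  "pos_diff a b = (if a \<le> b then 0 else a - b)"

definition lsc_on :: "'c::topological_space set \<Rightarrow> ('c \<Rightarrow> ereal) \<Rightarrow> bool" where
  "lsc_on S f \<longleftrightarrow> (\<forall>x\<in>S. f x \<le> Liminf (at x within S) f)"

text \<open>
  In \<^typ>\<open>ereal\<close>, \<open>\<infinity> - \<infinity> = \<infinity>\<close>.  So the value is \<open>\<infinity>\<close> unless both limiting risks are finite.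
\<close>

definition bagged_limit_risk :: "(ereal \<Rightarrow> ereal \<Rightarrow> ereal) \<Rightarrow> nat \<Rightarrow> ereal \<Rightarrow> ereal \<Rightarrow> ereal" where
  "bagged_limit_risk R M \<phi> \<psi> =
     (2 * R \<phi> \<psi> - R \<psi> \<psi>) + ereal (2 / real M) * (R \<psi> \<psi> - R \<phi> \<psi>)"

text \<open>
  Splagging uses $\min\{M, \lfloor n/k \rfloor\}$ bags; as $p/n \to \phi$ and $p/k \to \psi$, this
  is asymptotically $\min\{M, \lfloor \psi/\phi \rfloor\}$ (along suitable \<open>k\<close>, if
  $\psi/\phi$ is an integer).
\<close>

definition limit_num_bags :: "sampling \<Rightarrow> nat \<Rightarrow> ereal \<Rightarrow> ereal \<Rightarrow> nat" where
  "limit_num_bags s M \<phi> \<psi> =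
     (if s = Splag \<and> \<psi> \<noteq> \<infinity> then min M (nat \<lfloor>real_of_ereal \<psi> / real_of_ereal \<phi>\<rfloor>) else M)"

text \<open>
  The optimum over subsample aspect ratios in \<open>\<Psi>\<close>.  It need not be attained on
  \<open>{\<phi>..<\<infinity>}\<close>, e.g. if the limiting risk strictly decreases in the subsample aspect ratio.
\<close>

definition opt_limit_risk ::
  "sampling \<Rightarrow> (ereal \<Rightarrow> ereal \<Rightarrow> ereal) \<Rightarrow> nat \<Rightarrow> ereal set \<Rightarrow> ereal \<Rightarrow> ereal" where
  "opt_limit_risk s R M \<Psi> \<phi> = (INF \<psi>\<in>\<Psi>. bagged_limit_risk R (limit_num_bags s M \<phi> \<psi>) \<phi> \<psi>)"

end

theory Submission
  imports Defs
begin

text \<open>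
  The cross-validated subsample size \<open>khat\<close> minimises the estimated risk over the grid.  So it
  does at least as well, up to the estimation error, as any sequence of competitors $k_n$ in the
  grid, and only one well-chosen competitor has to be analysed at a time.  This is why limits along
  fixed sequences suffice, although the number of grid points grows.

  For a finite aspect ratio \<open>\<psi> \<ge> \<phi>\<close> the competitor is a grid point $k_n$ with $p / k_n \to \psi$
  (\<open>ex_grid_sequence\<close>).  Squared loss makes the risk of $m$ bags a linear combination of the risks
  of single bags and of pairs of bags (\<open>sub_risk_by_pairs\<close>), with coefficients that turn the limits
  \<open>R \<psi> \<psi>\<close> and \<open>R \<phi> \<psi>\<close> of condition (i) into \<open>bagged_limit_risk\<close>.  The limit for pairs applies
  to any two of the bags because any two members of a simple random sample are themselves a simple
  random sample of size two (\<open>pair_of_sample_uniform\<close>).  Hence almost surely the risk of the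
  competitor is eventually below any number above the limiting risk at \<open>\<psi>\<close>
  (\<open>risk_eventually_less\<close>), and, on an event of probability tending to one, so is the risk at
  \<open>khat\<close>, up to an arbitrarily small loss (\<open>ex_closeness_transfer\<close>).  Choosing \<open>\<psi>\<close> nearly optimal
  bounds the risk at \<open>khat\<close> by the infimum over \<open>\<psi>\<close>; no minimiser has to exist.

  The infimum is unaffected by \<open>\<psi> = \<infinity>\<close> if the limiting risks are continuous there, as the
  limiting risk at \<open>\<infinity>\<close> is then a limit of values at finite \<open>\<psi>\<close>.  For the monotonicity, the limiting
  risk is monotone in \<open>R \<phi> \<psi>\<close> and antitone in the number of bags, and for larger \<open>\<phi>\<close> there are fewer
  \<open>\<psi>\<close> to choose from.
\<close>

section \<open>Pairs of bags in a simple random sample\<close>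

definition bag_pair :: "nat \<Rightarrow> nat \<Rightarrow> (nat \<Rightarrow> 'i) \<Rightarrow> nat \<Rightarrow> 'i" where
  "bag_pair l j J = (\<lambda>i\<in>{..<2}. if i = 0 then J l else J j)"

text \<open>
  Requiring only one inequality between the sizes of two fibres is no loss, as the fibres can be
  exchanged, and an injection between them suffices to apply this.
\<close>

lemma map_pmf_of_set_equal_fibres:
  assumes "finite S" "S \<noteq> {}" "finite T" "f ` S \<subseteq> T"
    and eq: "\<And>y y'. y \<in> T \<Longrightarrow> y' \<in> T \<Longrightarrow> card {x \<in> S. f x = y} \<le> card {x \<in> S. f x = y'}"
  shows "map_pmf f (pmf_of_set S) = pmf_of_set T"
proof -
  have "T \<noteq> {}"
    using assms by auto
  then obtain y0 where y0: "y0 \<in> T"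
    by auto
  define c where "c = card {x \<in> S. f x = y0}"
  have c: "card {x \<in> S. f x = y} = c" if "y \<in> T" for y
    unfolding c_def using eq[OF that y0] eq[OF y0 that] by simp
  have "card S = (\<Sum>y\<in>T. card {x \<in> S. f x = y})"
    using sum.group[OF assms(1,3,4), of "\<lambda>_. 1::nat"] by simp
  then have S: "card S = card T * c"
    by (simp add: c)
  have c0: "c > 0"
    using S assms by (metis card_gt_0_iff mult_0_right neq0_conv)
  show ?thesis
  proof (rule pmf_eqI)
    fix y
    have "pmf (map_pmf f (pmf_of_set S)) y = real (card {x \<in> S. f x = y}) / real (card S)"
      using assms by (simp add: pmf_map measure_pmf_of_set vimage_def Int_def)
    also have "\<dots> = pmf (pmf_of_set T) y"
    proof (cases "y \<in> T")
      case True
      then show ?thesis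
        using c0 assms \<open>T \<noteq> {}\<close> by (simp add: c S)
    next
      case False
      then have "{x \<in> S. f x = y} = {}"
        using assms by auto
      then show ?thesis
        using False assms \<open>T \<noteq> {}\<close> by (metis card.empty div_0 indicator_simps(2) of_nat_0 pmf_of_set)
    qed
    finally show "pmf (map_pmf f (pmf_of_set S)) y = pmf (pmf_of_set T) y" .
  qed
qed

lemma samples_subset: "samples s Q m \<subseteq> {..<m} \<rightarrow>\<^sub>E Q"
  by (auto simp: samples_def split: sampling.splits)

lemma samples_in:
  "J \<in> samples s Q m \<Longrightarrow> l < m \<Longrightarrow> J l \<in> Q"
  using samples_subset[of s Q m] by (auto simp: PiE_iff)

lemma finite_samples: "finite Q \<Longrightarrow> finite (samples s Q m)"
  by (rule finite_subset[OF samples_subset]) (intro finite_PiE, auto)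

lemma samples_nonempty:
  assumes "finite Q" "Q \<noteq> {}" "s \<noteq> Subag_with_repl \<Longrightarrow> m \<le> card Q"
  shows "samples s Q m \<noteq> {}"
proof (cases "s = Subag_with_repl")
  case True
  then show ?thesis
    using assms by (auto simp: samples_def PiE_eq_empty_iff)
next
  case False
  then have "m \<le> card Q"
    using assms by auto
  then obtain g where g: "inj_on g {..<m}" "g ` {..<m} \<subseteq> Q"
    using card_le_inj[of "{..<m}" Q] assms by auto
  have "restrict g {..<m} \<in> samples s Q m"
    using g False by (cases s) (auto simp: samples_def inj_on_def)
  then show ?thesis
    by auto
qed

lemma samples_double:
  "g \<in> samples s Q 2 \<longleftrightarrow>
     g \<in> {..<2} \<rightarrow>\<^sub>E Q \<and> (s \<noteq> Subag_with_repl \<longrightarrow> g 0 \<noteq> g 1)"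
proof -
  have "inj_on g {..<2} \<longleftrightarrow> g 0 \<noteq> g 1"
    by (simp add: numeral_2_eq_2 lessThan_Suc)  auto
  then show ?thesis
    by (cases s) (auto simp: samples_def)
qed

lemma bag_pair_eq_iff:
  assumes "g \<in> {..<2} \<rightarrow>\<^sub>E Q"
  shows "bag_pair l j J = g \<longleftrightarrow> J l = g 0 \<and> J j = g 1"
proof
  assume "bag_pair l j J = g"
  then show "J l = g 0 \<and> J j = g 1"
    by (auto simp: bag_pair_def)
next
  assume a: "J l = g 0 \<and> J j = g 1"
  show "bag_pair l j J = g"
  proof
    fix i
    consider "i = 0" | "i = 1" | "\<not> i < (2::nat)"
      by linarith
    then show "bag_pair l j J i = g i"
      using a assms by cases (auto simp: bag_pair_def PiE_iff extensional_def)
  qed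
qed

lemma ex_transposition_pair:
  assumes "a \<in> Q" "b \<in> Q" "a' \<in> Q" "b' \<in> Q" "a \<noteq> b" "a' \<noteq> b'"
  obtains \<pi> where "inj \<pi>" "\<pi> ` Q \<subseteq> Q" "\<pi> a = a'" "\<pi> b = b'"
proof
  let ?t = "Transposition.transpose a a'"
  let ?\<pi> = "Transposition.transpose (?t b) b' \<circ> ?t"
  show "inj ?\<pi>"
    by (intro inj_compose) auto
  show "?\<pi> ` Q \<subseteq> Q"
    using assms by (auto simp: Transposition.transpose_def)
  show "?\<pi> a = a'" "?\<pi> b = b'"
    using assms by (auto simp: Transposition.transpose_def)
qed

text \<open>
  All values of a pair of bags arise from equally many samples: without replacement, relabelling
  the pool by a permutation that moves one pair of distinct bags to another maps samples with the
  one value to samples with the other; with replacement, overwriting the two entries does so.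
\<close>

lemma pair_of_sample_uniform:
  assumes Q: "finite Q" "Q \<noteq> {}" "s \<noteq> Subag_with_repl \<Longrightarrow> m \<le> card Q"
    and lj: "l < m" "j < m" "l \<noteq> j"
  shows "map_pmf (bag_pair l j) (pmf_of_set (samples s Q m)) = pmf_of_set (samples s Q 2)"
proof (rule map_pmf_of_set_equal_fibres)
  show "finite (samples s Q m)" "finite (samples s Q 2)" "samples s Q m \<noteq> {}"
    using Q finite_samples samples_nonempty by blast+
  show "bag_pair l j ` samples s Q m \<subseteq> samples s Q 2"
  proof
    fix g assume "g \<in> bag_pair l j ` samples s Q m"
    then obtain J where J: "J \<in> samples s Q m" "g = bag_pair l j J"
      by auto
    have "s \<noteq> Subag_with_repl \<Longrightarrow> inj_on J {..<m}"
      using J by (cases s) (auto simp: samples_def)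
    then have "s \<noteq> Subag_with_repl \<Longrightarrow> J l \<noteq> J j"
      using lj by (auto dest: inj_onD)
    then show "g \<in> samples s Q 2"
      using samples_in[OF J(1)] lj unfolding samples_double J(2)
      by (auto simp: bag_pair_def)
  qed
  fix g g' assume g: "g \<in> samples s Q 2" "g' \<in> samples s Q 2"
  then have gE: "g \<in> {..<2} \<rightarrow>\<^sub>E Q" "g' \<in> {..<2} \<rightarrow>\<^sub>E Q"
    by (auto simp: samples_double)
  have gQ: "g 0 \<in> Q" "g 1 \<in> Q" "g' 0 \<in> Q" "g' 1 \<in> Q"
    using gE by (auto simp: PiE_iff)
  let ?F = "\<lambda>g. {J \<in> samples s Q m. bag_pair l j J = g}"
  have "\<exists>h. inj_on h (?F g) \<and> h ` ?F g \<subseteq> ?F g'"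
  proof (cases "s = Subag_with_repl")
    case True
    let ?h = "\<lambda>J. J(l := g' 0, j := g' 1)"
    have "inj_on ?h (?F g)"
    proof (rule inj_onI)
      fix J J' assume a: "J \<in> ?F g" "J' \<in> ?F g" "?h J = ?h J'"
      show "J = J'"
      proof
        fix i
        show "J i = J' i"
          using a(1,2) fun_cong[OF a(3), of i] unfolding mem_Collect_eq bag_pair_eq_iff[OF gE(1)]
          by (auto split: if_splits)
      qed
    qed
    moreover have "?h ` ?F g \<subseteq> ?F g'"
      using True gQ lj
      by (auto simp: bag_pair_eq_iff[OF gE(1)] bag_pair_eq_iff[OF gE(2)] samples_def PiE_iff
            extensional_def)
    ultimately show ?thesis
      by blast
  next
    case False
    then obtain \<pi> where \<pi>: "inj \<pi>" "\<pi> ` Q \<subseteq> Q" "\<pi> (g 0) = g' 0" "\<pi> (g 1) = g' 1"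
      using ex_transposition_pair[of "g 0" Q "g 1" "g' 0" "g' 1"] gQ g
      by (auto simp: samples_double)
    let ?h = "\<lambda>J. restrict (\<pi> \<circ> J) {..<m}"
    have s: "samples s Q m = {J \<in> {..<m} \<rightarrow>\<^sub>E Q. inj_on J {..<m}}"
      using False by (cases s) (auto simp: samples_def)
    have "inj_on ?h (?F g)"
    proof (rule inj_onI)
      fix J J' assume a: "J \<in> ?F g" "J' \<in> ?F g" "?h J = ?h J'"
      have "J i = J' i" if "i < m" for i
        using fun_cong[OF a(3), of i] that \<pi>(1) by (auto dest: injD)
      moreover have "J \<in> extensional {..<m}" "J' \<in> extensional {..<m}"
        using a(1,2) unfolding s by (auto simp: PiE_iff)
      ultimately show "J = J'"
        by (intro extensionalityI) auto
    qed
    moreover have "?h J \<in> ?F g'" if "J \<in> ?F g" for J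
    proof -
      have "\<pi> (J i) \<in> Q" if "i < m" for i
        using \<pi>(2) \<open>J \<in> ?F g\<close> that unfolding s by (auto simp: PiE_iff)
      then show ?thesis
        using that lj \<pi> unfolding s
        by (auto simp: bag_pair_eq_iff[OF gE(1)] bag_pair_eq_iff[OF gE(2)] inj_on_def)
    qed
    ultimately show ?thesis
      by blast
  qed
  then show "card (?F g) \<le> card (?F g')"
    using finite_samples[OF Q(1)] by (auto intro: card_inj_on_le)
qed

text \<open>
  Splits exist; otherwise \<^const>\<open>pool_law\<close> for splagging would be the uniform law on the empty
  set, of which nothing is known.
\<close>

lemma ex_disjoint_parts:
  assumes "finite S" "1 \<le> k" "q * k \<le> card S"
  shows "\<exists>Q. (\<forall>I\<in>Q. I \<subseteq> S \<and> card I = k) \<and> pairwise disjnt Q \<and> finite Q \<and> card Q = q"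
  using assms(1,3)
proof (induction q arbitrary: S)
  case 0
  show ?case
    by (intro exI[of _ "{}"]) auto
next
  case (Suc q)
  obtain I where I: "I \<subseteq> S" "card I = k"
    using obtain_subset_with_card_n[of k S] Suc.prems by auto
  have "card (S - I) = card S - k"
    using I Suc.prems by (simp add: card_Diff_subset finite_subset)
  then obtain Q where Q: "\<forall>I'\<in>Q. I' \<subseteq> S - I \<and> card I' = k" "pairwise disjnt Q" "finite Q" "card Q = q"
    using Suc.IH[of "S - I"] Suc.prems by (auto simp: le_diff_conv2)
  have "I \<notin> Q"
    using Q(1) I assms(2) by (metis Diff_disjoint card.empty inf.absorb_iff2 inf_commute not_one_le_zero)
  moreover have "pairwise disjnt (insert I Q)"
    using Q(1,2) by (auto simp: pairwise_insert disjnt_def)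
  ultimately show ?case
    using Q I by (intro exI[of _ "insert I Q"]) auto
qed

lemma set_pmf_test_set_law:
  assumes "t \<le> n"
  shows "set_pmf (test_set_law n t) = {S. S \<subseteq> {..<n} \<and> card S = t}"
  unfolding test_set_law_def
proof (rule set_pmf_of_set)
  show "{S. S \<subseteq> {..<n} \<and> card S = t} \<noteq> {}"
    using obtain_subset_with_card_n[of t "{..<n}"] assms by auto
  show "finite {S. S \<subseteq> {..<n} \<and> card S = t}"
    by (rule finite_subset[of _ "Pow {..<n}"]) auto
qed

lemma pool_law_supported:
  assumes "finite S" "card S = r" "1 \<le> k" "k \<le> r" "Q \<in> set_pmf (pool_law s S k)"
  shows "Q \<subseteq> Pow S" "finite Q" "Q \<noteq> {}" "s \<noteq> Subag_with_repl \<Longrightarrow> num_bags s r k M \<le> card Q"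
proof -
  have "Q \<subseteq> Pow S \<and> (s \<noteq> Subag_with_repl \<longrightarrow> num_bags s r k M \<le> card Q) \<and> Q \<noteq> {}"
  proof (cases "s = Splag")
    case True
    have "splits_into_parts S k \<subseteq> Pow (Pow S)"
      by (auto simp: splits_into_parts_def)
    then have "finite (splits_into_parts S k)"
      using assms(1) by (meson finite_Pow_iff finite_subset)
    moreover have "splits_into_parts S k \<noteq> {}"
      using ex_disjoint_parts[of S k "card S div k"] assms by (auto simp: splits_into_parts_def)
    ultimately have Q: "Q \<in> splits_into_parts S k"
      using assms(5) True by (simp add: pool_law_def)
    then have "card Q = r div k"
      using assms by (simp add: splits_into_parts_def)
    moreover have "r div k \<ge> 1"
      using assms by (simp add: Suc_leI div_greater_zero_iff)
    ultimately show ?thesis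
      using Q True by (auto simp: splits_into_parts_def num_bags_def)
  next
    case False
    then have Q: "Q = {I. I \<subseteq> S \<and> card I = k}"
      using assms(5) by (cases s) (auto simp: pool_law_def)
    then have "card Q = r choose k"
      using n_subsets[of S k] assms by simp
    moreover have "r choose k > 0"
      using assms by simp
    moreover from this have "Q \<noteq> {}"
      unfolding Q by (metis \<open>card Q = r choose k\<close> Q card.empty less_nat_zero_code)
    ultimately show ?thesis
      using Q False by (cases s) (auto simp: num_bags_def)
  qed
  then show "Q \<subseteq> Pow S" "finite Q" "Q \<noteq> {}" "s \<noteq> Subag_with_repl \<Longrightarrow> num_bags s r k M \<le> card Q"
    using assms(1) by (auto dest: finite_subset)
qed

lemma bags_law_supported:
  assumes "t \<le> n" "1 \<le> k" "k \<le> n - t" "(S, Q, J) \<in> set_pmf (bags_law s n t k M)"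
  shows "J \<in> samples s Q (num_bags s (n - t) k M)" "Q \<subseteq> Pow {..<n}"
proof -
  have S: "S \<subseteq> {..<n}" "card S = t" and Q: "Q \<in> set_pmf (pool_law s ({..<n} - S) k)"
    and J: "J \<in> set_pmf (pmf_of_set (samples s Q (num_bags s (n - t) k M)))"
    using assms(4) by (auto simp: bags_law_def set_pmf_test_set_law[OF assms(1)])
  have "card ({..<n} - S) = n - t"
    using S by (simp add: card_Diff_subset finite_subset)
  note * = pool_law_supported[OF _ this assms(2,3) Q, simplified]
  show "Q \<subseteq> Pow {..<n}"
    using *(1) by auto
  show "J \<in> samples s Q (num_bags s (n - t) k M)"
    using J set_pmf_of_set[OF samples_nonempty finite_samples] *(2-4) by blast
qed

text \<open>
  Hypotheses on two bags drawn from the pool thereby apply to any two of the bags of the procedure,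
  jointly with the test set and the pool.
\<close>

lemma bags_law_pair:
  assumes "t \<le> n" "1 \<le> k" "k \<le> n - t" "num_bags s (n - t) k 2 = 2"
    and "l < num_bags s (n - t) k M" "j < num_bags s (n - t) k M" "l \<noteq> j"
  shows "map_pmf (\<lambda>(S, Q, J). (S, Q, bag_pair l j J)) (bags_law s n t k M) = bags_law s n t k 2"
  unfolding bags_law_def map_bind_pmf assms(4)
proof (rule bind_pmf_cong[OF refl], rule bind_pmf_cong[OF refl])
  fix S Q
  assume "S \<in> set_pmf (test_set_law n t)" and Q: "Q \<in> set_pmf (pool_law s ({..<n} - S) k)"
  then have S: "S \<subseteq> {..<n}" "card S = t"
    by (auto simp: set_pmf_test_set_law[OF assms(1)])
  have "card ({..<n} - S) = n - t"
    using S by (simp add: card_Diff_subset finite_subset)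
  note * = pool_law_supported[OF _ this assms(2,3) Q, simplified]
  have "map_pmf (bag_pair l j) (pmf_of_set (samples s Q (num_bags s (n - t) k M)))
      = pmf_of_set (samples s Q 2)"
    using * assms by (intro pair_of_sample_uniform) auto
  from this [symmetric] show "pmf_of_set (samples s Q (num_bags s (n - t) k M)) \<bind>
      (\<lambda>x. map_pmf (\<lambda>(S, Q, J). (S, Q, bag_pair l j J)) (return_pmf (S, Q, x))) =
    pmf_of_set (samples s Q 2) \<bind> (\<lambda>J. return_pmf (S, Q, J))"
    by (simp add: bind_map_pmf)
qed

lemma has_law_map:
  assumes "has_law A X q"
  shows "has_law A (\<lambda>w. g (X w)) (map_pmf g q)"
proof -
  have X: "X \<in> A \<rightarrow>\<^sub>M count_space UNIV" "\<And>w. w \<in> space A \<Longrightarrow> X w \<in> set_pmf q"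
    "distr A (count_space UNIV) X = measure_pmf q"
    using assms by (auto simp: has_law_def)
  have "distr A (count_space UNIV) (\<lambda>w. g (X w)) = distr (distr A (count_space UNIV) X) (count_space UNIV) g"
    using X(1) by (subst distr_distr) (auto simp: comp_def)
  also have "\<dots> = measure_pmf (map_pmf g q)"
    by (simp add: X(3) map_pmf_rep_eq)
  finally have "distr A (count_space UNIV) (\<lambda>w. g (X w)) = measure_pmf (map_pmf g q)" .
  moreover have "(\<lambda>w. g (X w)) \<in> A \<rightarrow>\<^sub>M count_space UNIV"
    by (rule measurable_compose[OF X(1)]) auto
  ultimately show ?thesis
    using X(2) by (auto simp: has_law_def)
qed

section \<open>Risks of bagged predictors\<close>

definition residual :: "procedure \<Rightarrow> (nat \<Rightarrow> obs) \<Rightarrow> nat set \<Rightarrow> obs \<Rightarrow> real" where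
  "residual f d I v = snd v - f (fst v) (subdata d I)"

lemma sub_risk_eq_residual:
  assumes "m \<ge> 1"
  shows "sub_risk P f d m J =
    enn2ereal (\<integral>\<^sup>+ v. ennreal (((\<Sum>l<m. residual f d (J l) v) / real m)\<^sup>2) \<partial>P)"
proof -
  have "(\<integral>\<^sup>+ (x, y). ennreal ((y - bagged f d m J x)\<^sup>2) \<partial>P)
      = (\<integral>\<^sup>+ v. ennreal (((\<Sum>l<m. residual f d (J l) v) / real m)\<^sup>2) \<partial>P)"
    using assms
    by (intro nn_integral_cong)
      (auto simp: residual_def bagged_def sum_subtractf diff_divide_distrib)
  then show ?thesis
    unfolding sub_risk_def by (rule arg_cong)
qed

lemma sub_risk_nonneg [simp]: "0 \<le> sub_risk P f d m J"
  by (simp add: sub_risk_def)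

lemma sub_risk_single:
  "sub_risk P f d 1 (\<lambda>_. I) = enn2ereal (\<integral>\<^sup>+ v. ennreal ((residual f d I v)\<^sup>2) \<partial>P)"
  by (subst sub_risk_eq_residual) auto

lemma sub_risk_bag_pair:
  "sub_risk P f d 2 (bag_pair l j J) =
    enn2ereal (\<integral>\<^sup>+ v. ennreal (((residual f d (J l) v + residual f d (J j) v) / 2)\<^sup>2) \<partial>P)"
  by (subst sub_risk_eq_residual) (auto simp: bag_pair_def numeral_2_eq_2)

lemma ennreal_weighted_sum:
  assumes "0 \<le> c" "\<And>i. i \<in> I \<Longrightarrow> 0 \<le> g i"
  shows "ennreal (\<Sum>i\<in>I. c * g i) = (\<Sum>i\<in>I. ennreal c * ennreal (g i))"
proof -
  have "ennreal (\<Sum>i\<in>I. c * g i) = (\<Sum>i\<in>I. ennreal (c * g i))"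
    using assms by (intro sum_ennreal[symmetric]) auto
  also have "\<dots> = (\<Sum>i\<in>I. ennreal c * ennreal (g i))"
    using assms by (intro sum.cong refl ennreal_mult) auto
  finally show ?thesis .
qed

lemma enn2ereal_weighted_sum:
  assumes "0 \<le> c"
  shows "enn2ereal (\<Sum>i\<in>I. ennreal c * g i) = (\<Sum>i\<in>I. ereal c * enn2ereal (g i))"
proof -
  have "enn2ereal (\<Sum>i\<in>I. ennreal c * g i) = (\<Sum>i\<in>I. enn2ereal (ennreal c * g i))"
    by (rule sum_enn2ereal[symmetric]) simp
  also have "\<dots> = (\<Sum>i\<in>I. ereal c * enn2ereal (g i))"
    using assms by (simp add: times_ennreal.rep_eq)
  finally show ?thesis .
qed

text \<open>
  Jensen's inequality.  It bounds the risk of bagging by risks of single bags alone, whatever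
  the joint behaviour of the bags and however their number varies.
\<close>

lemma sub_risk_le_single_risks:
  assumes m: "m \<ge> 1"
    and meas: "\<And>l. l < m \<Longrightarrow> residual f d (J l) \<in> borel_measurable P"
    and le: "\<And>l. l < m \<Longrightarrow> sub_risk P f d 1 (\<lambda>_. J l) \<le> c"
  shows "sub_risk P f d m J \<le> c"
proof -
  have "0 \<le> c"
    using order_trans[OF sub_risk_nonneg le[of 0]] m by simp
  then obtain C where C: "c = enn2ereal C"
    by (metis enn2ereal_e2ennreal)
  have "(\<integral>\<^sup>+ v. ennreal (((\<Sum>l<m. residual f d (J l) v) / real m)\<^sup>2) \<partial>P)
      \<le> (\<integral>\<^sup>+ v. (\<Sum>l<m. ennreal (1 / real m) * ennreal ((residual f d (J l) v)\<^sup>2)) \<partial>P)"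
  proof (rule nn_integral_mono)
    fix v
    let ?a = "\<lambda>l. residual f d (J l) v"
    have "(sum ?a {..<m} / real m)\<^sup>2 \<le> ((\<Sum>l<m. (?a l)\<^sup>2) * real m) / (real m)\<^sup>2"
      using sum_squared_le_sum_of_squares[of ?a "{..<m}"]
      unfolding power_divide by (intro divide_right_mono) auto
    also have "\<dots> = (\<Sum>l<m. 1 / real m * (?a l)\<^sup>2)"
      using m by (simp add: power2_eq_square sum_divide_distrib)
    finally have "ennreal ((sum ?a {..<m} / real m)\<^sup>2) \<le> ennreal (\<Sum>l<m. 1 / real m * (?a l)\<^sup>2)"
      by (rule ennreal_leI)
    also have "\<dots> = (\<Sum>l<m. ennreal (1 / real m) * ennreal ((?a l)\<^sup>2))"
      by (rule ennreal_weighted_sum) auto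
    finally show "ennreal ((sum ?a {..<m} / real m)\<^sup>2)
        \<le> (\<Sum>l<m. ennreal (1 / real m) * ennreal ((?a l)\<^sup>2))" .
  qed
  also have "\<dots> = (\<Sum>l<m. ennreal (1 / real m) * (\<integral>\<^sup>+ v. ennreal ((residual f d (J l) v)\<^sup>2) \<partial>P))"
    using meas by (subst nn_integral_sum) (auto simp: nn_integral_cmult)
  also have "\<dots> \<le> (\<Sum>l<m. ennreal (1 / real m) * C)"
    using le unfolding sub_risk_single C less_eq_ennreal.rep_eq[symmetric]
    by (intro sum_mono mult_left_mono) auto
  also have "\<dots> = ennreal (real m) * ennreal (1 / real m) * C"
    by (simp add: ennreal_of_nat_eq_real_of_nat mult.assoc)
  also have "\<dots> = C"
    using m by (simp flip: ennreal_mult)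
  finally show ?thesis
    unfolding sub_risk_eq_residual[OF m] C less_eq_ennreal.rep_eq .
qed

lemma square_of_mean_by_pairs:
  fixes a :: "nat \<Rightarrow> real"
  assumes "m \<ge> 1"
  shows "((\<Sum>l<m. a l) / real m)\<^sup>2 + (\<Sum>l<m. (real m - 2) / (real m)\<^sup>2 * (a l)\<^sup>2)
    = (\<Sum>l<m. \<Sum>j\<in>{..<m} - {l}. 2 / (real m)\<^sup>2 * ((a l + a j) / 2)\<^sup>2)"
proof -
  let ?S = "\<Sum>l<m. a l" and ?Q = "\<Sum>l<m. (a l)\<^sup>2"
  have "(\<Sum>j\<in>{..<m} - {l}. ((a l + a j) / 2)\<^sup>2) = (real m * (a l)\<^sup>2 + 2 * a l * ?S + ?Q) / 4 - (a l)\<^sup>2"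
    if "l < m" for l
  proof -
    have "(\<Sum>j\<in>{..<m} - {l}. ((a l + a j) / 2)\<^sup>2) = (\<Sum>j<m. ((a l + a j) / 2)\<^sup>2) - (a l)\<^sup>2"
      using that by (subst sum_diff1) auto
    also have "(\<Sum>j<m. ((a l + a j) / 2)\<^sup>2) = (\<Sum>j<m. ((a l)\<^sup>2 + 2 * a l * a j + (a j)\<^sup>2) / 4)"
      by (intro sum.cong refl) (simp add: power2_eq_square field_simps)
    also have "\<dots> = (real m * (a l)\<^sup>2 + 2 * a l * ?S + ?Q) / 4"
      by (simp add: sum.distrib sum_divide_distrib[symmetric] sum_distrib_left[symmetric])
    finally show ?thesis .
  qed
  then have "(\<Sum>l<m. \<Sum>j\<in>{..<m} - {l}. ((a l + a j) / 2)\<^sup>2)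
      = (\<Sum>l<m. (real m * (a l)\<^sup>2 + 2 * a l * ?S + ?Q) / 4 - (a l)\<^sup>2)"
    by (intro sum.cong) auto
  also have "\<dots> = (real m * ?Q + 2 * ?S * ?S + real m * ?Q) / 4 - ?Q"
    by (simp add: sum.distrib sum_subtractf sum_divide_distrib[symmetric]
        sum_distrib_left[symmetric] sum_distrib_right[symmetric])
  finally have "(\<Sum>l<m. \<Sum>j\<in>{..<m} - {l}. 2 / (real m)\<^sup>2 * ((a l + a j) / 2)\<^sup>2)
      = 2 / (real m)\<^sup>2 * ((real m * ?Q + 2 * ?S * ?S + real m * ?Q) / 4 - ?Q)"
    by (simp only: sum_distrib_left[symmetric])
  also have "\<dots> = (?S / real m)\<^sup>2 + (real m - 2) / (real m)\<^sup>2 * ?Q"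
    using assms by (simp add: field_simps power2_eq_square)
  finally show ?thesis
    by (simp add: sum_distrib_left)
qed

text \<open>
  The square of a mean is a linear combination of squares of single terms and of pair means, so
  the risk of any number of bags is determined by the risks of one and of two bags.  The terms
  with negative coefficient are on the left, as risks may be infinite.
\<close>

lemma sub_risk_by_pairs:
  assumes m: "m \<ge> 2"
    and meas: "\<And>l. l < m \<Longrightarrow> residual f d (J l) \<in> borel_measurable P"
  shows "sub_risk P f d m J
      + (\<Sum>l<m. ereal ((real m - 2) / (real m)\<^sup>2) * sub_risk P f d 1 (\<lambda>_. J l))
    = (\<Sum>l<m. \<Sum>j\<in>{..<m} - {l}. ereal (2 / (real m)\<^sup>2) * sub_risk P f d 2 (bag_pair l j J))"
proof -
  let ?a = "\<lambda>l. residual f d (J l)"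
  let ?c = "(real m - 2) / (real m)\<^sup>2" and ?c' = "2 / (real m)\<^sup>2"
  have c: "0 \<le> ?c" "0 \<le> ?c'"
    using m by auto
  have "(\<integral>\<^sup>+ v. ennreal (((\<Sum>l<m. ?a l v) / real m)\<^sup>2) \<partial>P)
      + (\<Sum>l<m. ennreal ?c * (\<integral>\<^sup>+ v. ennreal ((?a l v)\<^sup>2) \<partial>P))
    = (\<integral>\<^sup>+ v. ennreal (((\<Sum>l<m. ?a l v) / real m)\<^sup>2)
          + (\<Sum>l<m. ennreal ?c * ennreal ((?a l v)\<^sup>2)) \<partial>P)"
  proof -
    have "(\<Sum>l<m. ennreal ?c * (\<integral>\<^sup>+ v. ennreal ((?a l v)\<^sup>2) \<partial>P))
        = (\<integral>\<^sup>+ v. (\<Sum>l<m. ennreal ?c * ennreal ((?a l v)\<^sup>2)) \<partial>P)"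
      using meas by (subst nn_integral_sum) (auto simp: nn_integral_cmult)
    then show ?thesis
      using meas by (subst nn_integral_add) auto
  qed
  also have "\<dots> = (\<integral>\<^sup>+ v. (\<Sum>l<m. \<Sum>j\<in>{..<m} - {l}.
      ennreal ?c' * ennreal (((?a l v + ?a j v) / 2)\<^sup>2)) \<partial>P)"
  proof (rule nn_integral_cong)
    fix v
    have "ennreal (((\<Sum>l<m. ?a l v) / real m)\<^sup>2) + (\<Sum>l<m. ennreal ?c * ennreal ((?a l v)\<^sup>2))
      = ennreal (((\<Sum>l<m. ?a l v) / real m)\<^sup>2 + (\<Sum>l<m. ?c * (?a l v)\<^sup>2))"
    proof -
      have "(\<Sum>l<m. ennreal ?c * ennreal ((?a l v)\<^sup>2)) = ennreal (\<Sum>l<m. ?c * (?a l v)\<^sup>2)"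
        using c by (intro ennreal_weighted_sum[symmetric]) auto
      moreover have "0 \<le> (\<Sum>l<m. ?c * (?a l v)\<^sup>2)"
        using c by (intro sum_nonneg mult_nonneg_nonneg) auto
      ultimately show ?thesis
        by (simp only: ennreal_plus zero_le_power2)
    qed
    also have "\<dots> = ennreal (\<Sum>l<m. \<Sum>j\<in>{..<m} - {l}. ?c' * ((?a l v + ?a j v) / 2)\<^sup>2)"
      using m by (subst square_of_mean_by_pairs) auto
    also have "\<dots> = (\<Sum>l<m. ennreal (\<Sum>j\<in>{..<m} - {l}. ?c' * ((?a l v + ?a j v) / 2)\<^sup>2))"
      using c by (intro sum_ennreal[symmetric] sum_nonneg mult_nonneg_nonneg) auto
    also have "\<dots> = (\<Sum>l<m. \<Sum>j\<in>{..<m} - {l}. ennreal ?c' * ennreal (((?a l v + ?a j v) / 2)\<^sup>2))"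
      using c by (intro sum.cong refl ennreal_weighted_sum) auto
    finally show "ennreal (((\<Sum>l<m. ?a l v) / real m)\<^sup>2) + (\<Sum>l<m. ennreal ?c * ennreal ((?a l v)\<^sup>2))
      = \<dots>" .
  qed
  also have "\<dots> = (\<Sum>l<m. \<Sum>j\<in>{..<m} - {l}.
      ennreal ?c' * (\<integral>\<^sup>+ v. ennreal (((?a l v + ?a j v) / 2)\<^sup>2) \<partial>P))"
  proof -
    have meas2: "(\<lambda>v. ennreal (((?a l v + ?a j v) / 2)\<^sup>2)) \<in> borel_measurable P"
      if "l < m" "j < m" for l j
      using meas[OF that(1)] meas[OF that(2)] by measurable
    have "(\<integral>\<^sup>+ v. (\<Sum>l<m. \<Sum>j\<in>{..<m} - {l}. ennreal ?c' * ennreal (((?a l v + ?a j v) / 2)\<^sup>2)) \<partial>P)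
      = (\<Sum>l<m. \<integral>\<^sup>+ v. (\<Sum>j\<in>{..<m} - {l}. ennreal ?c' * ennreal (((?a l v + ?a j v) / 2)\<^sup>2)) \<partial>P)"
      by (rule nn_integral_sum)
        (auto intro!: borel_measurable_sum borel_measurable_times_ennreal meas2)
    also have "\<dots> = (\<Sum>l<m. \<Sum>j\<in>{..<m} - {l}.
        \<integral>\<^sup>+ v. ennreal ?c' * ennreal (((?a l v + ?a j v) / 2)\<^sup>2) \<partial>P)"
      by (intro sum.cong refl nn_integral_sum)
        (auto intro!: borel_measurable_times_ennreal meas2)
    also have "\<dots> = (\<Sum>l<m. \<Sum>j\<in>{..<m} - {l}.
        ennreal ?c' * (\<integral>\<^sup>+ v. ennreal (((?a l v + ?a j v) / 2)\<^sup>2) \<partial>P))"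
      by (intro sum.cong refl nn_integral_cmult meas2) auto
    finally show ?thesis .
  qed
  finally have "enn2ereal ((\<integral>\<^sup>+ v. ennreal (((\<Sum>l<m. ?a l v) / real m)\<^sup>2) \<partial>P)
      + (\<Sum>l<m. ennreal ?c * (\<integral>\<^sup>+ v. ennreal ((?a l v)\<^sup>2) \<partial>P)))
    = enn2ereal (\<Sum>l<m. \<Sum>j\<in>{..<m} - {l}.
        ennreal ?c' * (\<integral>\<^sup>+ v. ennreal (((?a l v + ?a j v) / 2)\<^sup>2) \<partial>P))"
    by simp
  also have "\<dots> = (\<Sum>l<m. enn2ereal (\<Sum>j\<in>{..<m} - {l}.
        ennreal ?c' * (\<integral>\<^sup>+ v. ennreal (((?a l v + ?a j v) / 2)\<^sup>2) \<partial>P)))"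
    by (rule sum_enn2ereal[symmetric]) simp
  also have "\<dots> = (\<Sum>l<m. \<Sum>j\<in>{..<m} - {l}. ereal ?c' * sub_risk P f d 2 (bag_pair l j J))"
    unfolding sub_risk_bag_pair using c by (intro sum.cong refl enn2ereal_weighted_sum) auto
  finally show ?thesis
    using m unfolding plus_ennreal.rep_eq enn2ereal_weighted_sum[OF c(1)] sub_risk_single
    by (subst sub_risk_eq_residual) auto
qed

section \<open>The limiting risk of several bags\<close>

lemma bagged_limit_risk_finite:
  assumes "R a b = ereal x" "R b b = ereal y"
  shows "bagged_limit_risk R m a b = ereal ((2 * x - y) + 2 / real m * (y - x))"
  using assms by (simp add: bagged_limit_risk_def)

text \<open>
  Thus a finite limiting risk comes from finite risks of single bags and of pairs.  For \<open>m = 0\<close>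
  this fails, as then \<open>2 / real m = 0\<close> and the value may be \<open>-\<infinity>\<close>.
\<close>

lemma bagged_limit_risk_infinite:
  assumes "m > 0" "0 \<le> R a b" "0 \<le> R b b" "R a b = \<infinity> \<or> R b b = \<infinity>"
  shows "bagged_limit_risk R m a b = \<infinity>"
  using assms by (cases "R a b"; cases "R b b") (auto simp: bagged_limit_risk_def)

text \<open>
  The limit of \<open>sub_risk_by_pairs\<close>: there are \<open>m\<close> single bags and \<open>m * (m - 1)\<close> ordered pairs.
  The subtraction is legitimate since the risks of single bags are eventually finite.
\<close>

lemma sub_risk_bagged_limit:
  assumes m: "m \<ge> 2"
    and meas: "\<forall>\<^sub>F n in sequentially. \<forall>l<m. residual (f n) (d n) (J n l) \<in> borel_measurable (P n)"
    and one: "\<And>l. l < m \<Longrightarrow> (\<lambda>n. sub_risk (P n) (f n) (d n) 1 (\<lambda>_. J n l)) \<longlonglongrightarrow> ereal y"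
    and two: "\<And>l j. l < m \<Longrightarrow> j < m \<Longrightarrow> l \<noteq> j \<Longrightarrow>
        (\<lambda>n. sub_risk (P n) (f n) (d n) 2 (bag_pair l j (J n))) \<longlonglongrightarrow> ereal x"
  shows "(\<lambda>n. sub_risk (P n) (f n) (d n) m (J n)) \<longlonglongrightarrow> ereal ((2 * x - y) + 2 / real m * (y - x))"
proof -
  let ?U = "\<lambda>n. \<Sum>l<m. ereal ((real m - 2) / (real m)\<^sup>2) * sub_risk (P n) (f n) (d n) 1 (\<lambda>_. J n l)"
  let ?W = "\<lambda>n. \<Sum>l<m. \<Sum>j\<in>{..<m} - {l}.
    ereal (2 / (real m)\<^sup>2) * sub_risk (P n) (f n) (d n) 2 (bag_pair l j (J n))"
  define u where "u = (\<Sum>l<m. (real m - 2) / (real m)\<^sup>2 * y)"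
  define w where "w = (\<Sum>l<m. \<Sum>j\<in>{..<m} - {l}. 2 / (real m)\<^sup>2 * x)"
  have U: "?U \<longlonglongrightarrow> ereal u"
    unfolding u_def sum_ereal[symmetric] times_ereal.simps(1)[symmetric]
    by (intro tendsto_sum_ereal tendsto_cmult_ereal one) auto
  have W: "?W \<longlonglongrightarrow> ereal w"
    unfolding w_def sum_ereal[symmetric] times_ereal.simps(1)[symmetric]
    by (intro tendsto_sum_ereal tendsto_cmult_ereal two) auto
  have "(\<lambda>n. ?W n - ?U n) \<longlonglongrightarrow> ereal w - ereal u"
    by (rule tendsto_diff_ereal[OF _ _ W U]) auto
  moreover have "w - u = (2 * x - y) + 2 / real m * (y - x)"
  proof -
    have "u = real m * ((real m - 2) / (real m)\<^sup>2 * y)"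
      by (simp add: u_def)
    moreover have "w = real m * ((real m - 1) * (2 / (real m)\<^sup>2 * x))"
      using m by (simp add: w_def card_Diff_singleton of_nat_diff)
    moreover have "r * ((r - 1) * (2 / r\<^sup>2 * x)) - r * ((r - 2) / r\<^sup>2 * y)
        = (2 * x - y) + 2 / r * (y - x)" if "r > 0" for r :: real
      using that by (simp add: divide_simps power2_eq_square) (simp add: algebra_simps)
    ultimately show ?thesis
      using m by simp
  qed
  moreover have "\<forall>\<^sub>F n in sequentially. ?W n - ?U n = sub_risk (P n) (f n) (d n) m (J n)"
  proof -
    have "\<forall>\<^sub>F n in sequentially. ?U n < ereal (u + 1)"
      by (rule order_tendstoD(2)[OF U]) simp
    with meas show ?thesis
    proof eventually_elim
      case (elim n)
      have "0 \<le> ?U n"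
        using m by (intro sum_nonneg ereal_0_le_mult sub_risk_nonneg) simp
      with elim(2) have "\<bar>?U n\<bar> \<noteq> \<infinity>"
        by (cases "?U n") simp_all
      moreover have "sub_risk (P n) (f n) (d n) m (J n) + ?U n = ?W n"
        using elim(1) by (intro sub_risk_by_pairs m) simp
      ultimately show ?case
        by (rule sym[OF iffD2[OF ereal_eq_minus]])
    qed
  qed
  ultimately show ?thesis
    by (simp only: tendsto_cong ereal_minus)
qed

section \<open>Subsample sizes with a prescribed aspect ratio\<close>

text \<open>
  The size $k_n$ is the largest multiple of $k_0$ that is at most $(n - n_{te}) \phi / \psi$.
  Approximation from below ensures that, for splagging, the number of parts
  $\lfloor (n - n_{te}) / k_n \rfloor$ converges to $\lfloor \psi / \phi \rfloor$ also if
  $\psi / \phi$ is an integer.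
\<close>

lemma ex_grid_sequence:
  fixes p nte :: "nat \<Rightarrow> nat" and \<nu> \<phi> \<psi> :: real
  assumes nu: "0 < \<nu>" "\<nu> < 1" and phi: "0 < \<phi>" "\<phi> \<le> \<psi>"
    and aspect: "(\<lambda>n. real (p n) / real n) \<longlonglongrightarrow> \<phi>"
    and nte: "\<And>n. n \<ge> 2 \<Longrightarrow> nte n < n"
    and nte_small: "(\<lambda>n. real (nte n) / real n) \<longlonglongrightarrow> 0"
  obtains k where
    "\<forall>\<^sub>F n in sequentially. k n \<in> grid \<nu> n (nte n)"
    "filterlim k at_top sequentially"
    "(\<lambda>n. real (p n) / real (k n)) \<longlonglongrightarrow> \<psi>"
    "\<forall>\<^sub>F n in sequentially. real (k n) * \<psi> \<le> real (n - nte n) * \<phi>"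
    "(\<lambda>n. real (n - nte n) / real (k n)) \<longlonglongrightarrow> \<psi> / \<phi>"
proof -
  define k0 where "k0 n = nat \<lfloor>real n powr \<nu>\<rfloor>" for n
  define q where "q n = real (n - nte n) * (\<phi> / \<psi>)" for n
  define j where "j n = nat \<lfloor>q n / real (k0 n)\<rfloor>" for n
  define k where "k n = j n * k0 n" for n
  have psi: "0 < \<psi>"
    using phi by simp
  have q_le: "q n \<le> real (n - nte n)" for n
    unfolding q_def using phi by (intro mult_left_le) auto
  have q_nonneg: "0 \<le> q n" for n
    unfolding q_def using phi by simp
  have k0_pos: "k0 n > 0" if "n \<ge> 1" for n
  proof -
    have "1 \<le> real n powr \<nu>"
      using that nu by (simp add: ge_one_powr_ge_zero)
    then show ?thesis
      unfolding k0_def by (simp add: le_floor_iff)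
  qed
  have k_le: "real (k n) \<le> q n" and k_ge: "q n - real (k0 n) \<le> real (k n)" if "n \<ge> 1" for n
  proof -
    have x: "0 \<le> q n / real (k0 n)"
      using q_nonneg by simp
    have "real (j n) \<le> q n / real (k0 n)" "q n / real (k0 n) < real (j n) + 1"
      unfolding j_def using x by linarith+
    then show "real (k n) \<le> q n" "q n - real (k0 n) \<le> real (k n)"
      using k0_pos[OF that] by (simp_all add: k_def field_simps)
  qed
  have "(\<lambda>n. real (k0 n) / real n) \<longlonglongrightarrow> 0"
  proof (rule tendsto_sandwich[of "\<lambda>_. 0" _ _ "\<lambda>n. real n powr (\<nu> - 1)"])
    show "\<forall>\<^sub>F n in sequentially. real (k0 n) / real n \<le> real n powr (\<nu> - 1)"
    proof (rule eventually_sequentiallyI)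
      fix n :: nat assume n: "1 \<le> n"
      have "real (k0 n) \<le> real n powr \<nu>"
        unfolding k0_def by simp
      then show "real (k0 n) / real n \<le> real n powr (\<nu> - 1)"
        using n by (simp add: powr_diff divide_right_mono)
    qed
    show "(\<lambda>n. real n powr (\<nu> - 1)) \<longlonglongrightarrow> 0"
      using nu by (intro tendsto_neg_powr filterlim_real_sequentially) auto
  qed auto
  moreover have r: "(\<lambda>n. real (n - nte n) / real n) \<longlonglongrightarrow> 1"
  proof -
    have "(\<lambda>n. 1 - real (nte n) / real n) \<longlonglongrightarrow> 1 - 0"
      by (intro tendsto_intros nte_small)
    moreover have "\<forall>\<^sub>F n in sequentially. 1 - real (nte n) / real n = real (n - nte n) / real n"
      using nte by (intro eventually_sequentiallyI[of 2])
        (auto simp: of_nat_diff less_imp_le diff_divide_distrib)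
    ultimately have "(\<lambda>n. real (n - nte n) / real n) \<longlonglongrightarrow> 1 - 0"
      by (rule Lim_transform_eventually)
    then show ?thesis
      by simp
  qed
  moreover have "(\<lambda>n. q n / real n) \<longlonglongrightarrow> \<phi> / \<psi>"
    using tendsto_mult_right[OF r, of "\<phi> / \<psi>"] by (simp add: q_def mult_ac)
  ultimately have "(\<lambda>n. real (k n) / real n) \<longlonglongrightarrow> \<phi> / \<psi>"
  proof -
    assume a: "(\<lambda>n. real (k0 n) / real n) \<longlonglongrightarrow> 0" and b: "(\<lambda>n. q n / real n) \<longlonglongrightarrow> \<phi> / \<psi>"
    have "(\<lambda>n. q n / real n - real (k0 n) / real n) \<longlonglongrightarrow> \<phi> / \<psi>"
      using tendsto_diff[OF b a] by simp
    then show ?thesis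
    proof (rule tendsto_sandwich[rotated 2, OF _ b])
      show "\<forall>\<^sub>F n in sequentially. q n / real n - real (k0 n) / real n \<le> real (k n) / real n"
        using k_ge by (intro eventually_sequentiallyI[of 1])
          (auto simp: diff_divide_distrib[symmetric] intro!: divide_right_mono)
      show "\<forall>\<^sub>F n in sequentially. real (k n) / real n \<le> q n / real n"
        using k_le by (intro eventually_sequentiallyI[of 1]) (auto intro!: divide_right_mono)
    qed
  qed
  note kn = this
  have pos: "\<phi> / \<psi> > 0"
    using phi psi by simp
  have k_top: "filterlim k at_top sequentially"
  proof -
    have "filterlim (\<lambda>n. real (k n) / real n * real n) at_top sequentially"
      by (rule filterlim_tendsto_pos_mult_at_top[OF kn pos filterlim_real_sequentially])
    moreover have "\<forall>\<^sub>F n in sequentially. real (k n) / real n * real n = real (k n)"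
      by (intro eventually_sequentiallyI[of 1]) auto
    ultimately have "filterlim (\<lambda>n. real (k n)) at_top sequentially"
      by (simp cong: filterlim_cong)
    then show ?thesis
      by (simp add: filterlim_at_top)
        (metis (mono_tags, lifting) eventually_mono of_nat_le_iff)
  qed
  show thesis
  proof (rule that[of k])
    show "filterlim k at_top sequentially"
      by (rule k_top)
    have "(\<lambda>n. (real (p n) / real n) / (real (k n) / real n)) \<longlonglongrightarrow> \<phi> / (\<phi> / \<psi>)"
      using pos by (intro tendsto_divide aspect kn) auto
    moreover have "\<forall>\<^sub>F n in sequentially. (real (p n) / real n) / (real (k n) / real n) = real (p n) / real (k n)"
      by (intro eventually_sequentiallyI[of 1]) auto
    ultimately have "(\<lambda>n. real (p n) / real (k n)) \<longlonglongrightarrow> \<phi> / (\<phi> / \<psi>)"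
      by (rule Lim_transform_eventually)
    then show "(\<lambda>n. real (p n) / real (k n)) \<longlonglongrightarrow> \<psi>"
      using phi by simp
    have "(\<lambda>n. (real (n - nte n) / real n) / (real (k n) / real n)) \<longlonglongrightarrow> 1 / (\<phi> / \<psi>)"
      using pos by (intro tendsto_divide r kn) auto
    moreover have "\<forall>\<^sub>F n in sequentially. (real (n - nte n) / real n) / (real (k n) / real n) = real (n - nte n) / real (k n)"
      by (intro eventually_sequentiallyI[of 1]) auto
    ultimately have "(\<lambda>n. real (n - nte n) / real (k n)) \<longlonglongrightarrow> 1 / (\<phi> / \<psi>)"
      by (rule Lim_transform_eventually)
    then show "(\<lambda>n. real (n - nte n) / real (k n)) \<longlonglongrightarrow> \<psi> / \<phi>"
      using phi by simp
    show "\<forall>\<^sub>F n in sequentially. real (k n) * \<psi> \<le> real (n - nte n) * \<phi>"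
      using k_le psi by (intro eventually_sequentiallyI[of 1]) (auto simp: q_def field_simps)
    have "\<forall>\<^sub>F n in sequentially. k n \<ge> 1"
      using k_top by (simp add: filterlim_at_top)
    then show "\<forall>\<^sub>F n in sequentially. k n \<in> grid \<nu> n (nte n)"
      using eventually_ge_at_top[of 1]
    proof eventually_elim
      case (elim n)
      have "k n \<le> n - nte n"
        using k_le[OF elim(2)] q_le[of n] by linarith
      moreover from this have "j n \<le> n div k0 n"
        using k0_pos[OF elim(2)] by (simp add: less_eq_div_iff_mult_less_eq k_def)
      moreover have "1 \<le> j n"
        using elim(1) by (cases "j n") (auto simp: k_def)
      ultimately show ?case
        unfolding grid_def Let_def k_def k0_def[symmetric] by auto
    qed
  qed
qed

text \<open>
  Unless the subsamples are the whole training set, sampling without replacement can provide \<open>M\<close>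
  bags as soon as there are \<open>M\<close> training observations.
\<close>

lemma le_binomial:
  assumes "1 \<le> k" "k < r"
  shows "r \<le> r choose k"
  using assms
proof (induction r arbitrary: k)
  case (Suc r)
  obtain k' where k: "k = Suc k'"
    using Suc.prems by (cases k) auto
  show ?case
  proof (cases "k = r")
    case False
    then have "r \<le> r choose k"
      using Suc by auto
    moreover have "1 \<le> r choose k'"
      using Suc.prems k by (simp add: Suc_leI)
    ultimately show ?thesis
      by (simp add: k)
  qed simp
qed simp

lemma eventually_num_bags_eq_limit:
  fixes \<phi> \<psi> :: real
  assumes phi: "0 < \<phi>" "\<phi> \<le> \<psi>" and s: "s = Subag_without_repl \<Longrightarrow> \<phi> < \<psi>"
    and k: "filterlim k at_top sequentially"
    and le: "\<forall>\<^sub>F n in sequentially. real (k n) * \<psi> \<le> real (r n) * \<phi>"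
    and ratio: "(\<lambda>n. real (r n) / real (k n)) \<longlonglongrightarrow> \<psi> / \<phi>"
  shows "\<forall>\<^sub>F n in sequentially. num_bags s (r n) (k n) M = limit_num_bags s M (ereal \<phi>) (ereal \<psi>)"
proof (cases s)
  case Subag_with_repl
  then show ?thesis
    by (simp add: num_bags_def limit_num_bags_def)
next
  case Subag_without_repl
  have "1 < \<psi> / \<phi>"
    using s[OF Subag_without_repl] phi by simp
  then have "\<forall>\<^sub>F n in sequentially. 1 < real (r n) / real (k n)"
    using ratio by (rule order_tendstoD(1)[rotated])
  moreover have "\<forall>\<^sub>F n in sequentially. k n \<ge> max 1 M"
    using k unfolding filterlim_at_top by blast
  ultimately show ?thesis
  proof eventually_elim
    case (elim n)
    then have "k n < r n" "1 \<le> k n" "M \<le> k n"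
      by (auto simp: less_divide_eq)
    then have "M \<le> r n choose k n"
      using le_binomial[of "k n" "r n"] by linarith
    then show ?case
      using Subag_without_repl by (simp add: num_bags_def limit_num_bags_def)
  qed
next
  case Splag
  define q where "q = nat \<lfloor>\<psi> / \<phi>\<rfloor>"
  have "0 \<le> \<psi> / \<phi>"
    using phi by simp
  then have q: "real q \<le> \<psi> / \<phi>" "\<psi> / \<phi> < real q + 1"
    unfolding q_def by linarith+
  have "\<forall>\<^sub>F n in sequentially. real (r n) / real (k n) < real q + 1"
    using ratio q(2) by (rule order_tendstoD(2))
  moreover have "\<forall>\<^sub>F n in sequentially. k n \<ge> 1"
    using k by (simp add: filterlim_at_top)
  ultimately have "\<forall>\<^sub>F n in sequentially. r n div k n = q"
    using le
  proof eventually_elim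
    case (elim n)
    have "real q * \<phi> \<le> \<psi>"
      using q(1) phi by (simp add: field_simps)
    then have "real q * \<phi> * real (k n) \<le> \<psi> * real (k n)"
      by (intro mult_right_mono) auto
    then have "(real q * real (k n)) * \<phi> \<le> real (r n) * \<phi>"
      using elim(3) by (simp add: mult_ac)
    then have "real (q * k n) \<le> real (r n)"
      using phi by simp
    moreover have "real (r n) < real (Suc q * k n)"
      using elim(1,2) by (simp add: divide_less_eq algebra_simps)
    ultimately have "q * k n \<le> r n" "r n < Suc q * k n"
      by (simp_all only: of_nat_le_iff of_nat_less_iff)
    then show ?case
      by (intro div_nat_eqI) (auto simp: mult.commute)
  qed
  then show ?thesis
    by eventually_elim (simp add: Splag num_bags_def limit_num_bags_def q_def)
qed

section \<open>Bagging over random subsamples\<close>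

text \<open>
  The setting of the procedure together with condition (i).  How the risk is estimated and how the
  subsample size is selected is left open.
\<close>

locale subsample_bagging = pair_prob_space D A for D :: "'a measure" and A :: "'b measure" +
  fixes p nte :: "nat \<Rightarrow> nat"
    and P :: "nat \<Rightarrow> obs measure"
    and z :: "nat \<Rightarrow> 'a \<Rightarrow> nat \<Rightarrow> obs"
    and fhat :: "nat \<Rightarrow> procedure"
    and \<nu> \<phi> :: real
    and M :: nat
    and s :: sampling
    and Ste :: "nat \<Rightarrow> 'b \<Rightarrow> nat set"
    and pool :: "nat \<Rightarrow> nat \<Rightarrow> 'b \<Rightarrow> nat set set"
    and bags :: "nat \<Rightarrow> nat \<Rightarrow> 'b \<Rightarrow> nat \<Rightarrow> nat set"
    and R :: "ereal \<Rightarrow> ereal \<Rightarrow> ereal"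
  assumes phi_pos: "\<phi> > 0"
    and aspect: "(\<lambda>n. real (p n) / real n) \<longlonglongrightarrow> \<phi>"
    and z_indep: "\<And>n. prob_space.indep_vars D (\<lambda>_. obs_space (p n)) (\<lambda>i \<omega>. z n \<omega> i) {..<n}"
    and z_law: "\<And>n i. i < n \<Longrightarrow> distr D (obs_space (p n)) (\<lambda>\<omega>. z n \<omega> i) = P n"
    and fhat_measurable: "\<And>q I. finite I \<Longrightarrow>
          (\<lambda>(x, d). fhat q x (subdata d I))
            \<in> borel_measurable (feature_space q \<Otimes>\<^sub>M PiM I (\<lambda>_. obs_space q))"
    and M_pos: "M \<ge> 1"
    and nu: "0 < \<nu>" "\<nu> < 1"
    and nte: "\<And>n. n \<ge> 2 \<Longrightarrow> 0 < nte n \<and> nte n < n"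
    and nte_small: "(\<lambda>n. real (nte n) / real n) \<longlonglongrightarrow> 0"
    and bags: "\<And>n k. n \<ge> 2 \<Longrightarrow> k \<in> grid \<nu> n (nte n) \<Longrightarrow>
          has_law A (\<lambda>w. (Ste n w, pool n k w, bags n k w)) (bags_law s n (nte n) k M)"
    and R_nonneg: "\<And>a b. 0 < a \<Longrightarrow> 0 < b \<Longrightarrow> 0 \<le> R a b"
    and conv1: "\<And>\<phi>s k I. \<phi> \<le> \<phi>s \<Longrightarrow>
          \<forall>\<^sub>F n in sequentially. k n \<in> grid \<nu> n (nte n) \<Longrightarrow>
          filterlim k at_top sequentially \<Longrightarrow>
          (\<lambda>n. real (p n) / real (k n)) \<longlonglongrightarrow> \<phi>s \<Longrightarrow>
          \<forall>\<^sub>F n in sequentially. I n \<in> A \<rightarrow>\<^sub>M count_space UNIV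
             \<and> (\<forall>w\<in>space A. I n w \<in> pool n (k n) w) \<Longrightarrow>
          AE v in D \<Otimes>\<^sub>M A.
            (\<lambda>n. sub_risk (P n) (fhat (p n)) (z n (fst v)) 1 (\<lambda>_. I n (snd v)))
              \<longlonglongrightarrow> R (ereal \<phi>s) (ereal \<phi>s)"
    and conv2: "\<And>\<phi>s k J. \<phi> \<le> \<phi>s \<Longrightarrow>
          \<forall>\<^sub>F n in sequentially. k n \<in> grid \<nu> n (nte n) \<Longrightarrow>
          filterlim k at_top sequentially \<Longrightarrow>
          (\<lambda>n. real (p n) / real (k n)) \<longlonglongrightarrow> \<phi>s \<Longrightarrow>
          \<forall>\<^sub>F n in sequentially. num_bags s (n - nte n) (k n) 2 = 2
             \<and> has_law A (\<lambda>w. (Ste n w, pool n (k n) w, J n w)) (bags_law s n (nte n) (k n) 2) \<Longrightarrow>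
          AE v in D \<Otimes>\<^sub>M A.
            (\<lambda>n. sub_risk (P n) (fhat (p n)) (z n (fst v)) 2 (J n (snd v)))
              \<longlonglongrightarrow> R (ereal \<phi>) (ereal \<phi>s)"
begin

abbreviation grid_n :: "nat \<Rightarrow> nat set" where
  "grid_n n \<equiv> grid \<nu> n (nte n)"

abbreviation num_bags_n :: "nat \<Rightarrow> nat \<Rightarrow> nat" where
  "num_bags_n n k \<equiv> num_bags s (n - nte n) k M"

definition risk :: "nat \<Rightarrow> nat \<Rightarrow> 'a \<times> 'b \<Rightarrow> ereal" where
  "risk n k v = sub_risk (P n) (fhat (p n)) (z n (fst v)) (num_bags_n n k) (bags n k (snd v))"

section \<open>Measurability of the conditional risk\<close>

lemma grid_bounds:
  assumes "n \<ge> 2" "k \<in> grid_n n"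
  shows "1 \<le> k" "k \<le> n - nte n"
proof -
  have "1 \<le> real n powr \<nu>"
    using assms nu by (simp add: ge_one_powr_ge_zero)
  then have k0: "1 \<le> nat \<lfloor>real n powr \<nu>\<rfloor>"
    by (simp add: le_nat_floor)
  obtain j where j: "k = j * nat \<lfloor>real n powr \<nu>\<rfloor>" "1 \<le> j" "k \<le> n - nte n"
    using assms(2) unfolding grid_def Let_def by blast
  show "1 \<le> k"
    using mult_le_mono[OF j(2) k0] unfolding j(1) by (simp only: mult_1)
  show "k \<le> n - nte n"
    by (rule j(3))
qed

lemma finite_grid:
  assumes "n \<ge> 2"
  shows "finite (grid_n n)"
  by (rule finite_subset[of _ "{..n - nte n}"]) (auto intro: grid_bounds(2)[OF assms])

lemma num_bags_pos:
  assumes "n \<ge> 2" "k \<in> grid_n n"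
  shows "1 \<le> num_bags_n n k"
proof -
  have "1 \<le> (n - nte n) choose k" "1 \<le> (n - nte n) div k"
    using grid_bounds[OF assms] by (simp_all add: Suc_leI div_greater_zero_iff)
  then show ?thesis
    using M_pos by (cases s) (auto simp: num_bags_def)
qed

lemma num_bags_le: "num_bags_n n k \<le> M"
  by (cases s) (auto simp: num_bags_def)

lemma bags_measurable:
  assumes "n \<ge> 2" "k \<in> grid_n n"
  shows "bags n k \<in> A \<rightarrow>\<^sub>M count_space UNIV"
proof -
  have "(\<lambda>w. (Ste n w, pool n k w, bags n k w)) \<in> A \<rightarrow>\<^sub>M count_space UNIV"
    using bags[OF assms] by (simp add: has_law_def)
  from measurable_compose[OF this, of "\<lambda>x. snd (snd x)"] show ?thesis
    by simp
qed

lemma bags_in_samples: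
  assumes "n \<ge> 2" "k \<in> grid_n n" "w \<in> space A"
  shows "bags n k w \<in> samples s (pool n k w) (num_bags_n n k)" "pool n k w \<subseteq> Pow {..<n}"
proof -
  have "(Ste n w, pool n k w, bags n k w) \<in> set_pmf (bags_law s n (nte n) k M)"
    using bags[OF assms(1,2)] assms(3) by (auto simp: has_law_def)
  note bags_law_supported[OF _ grid_bounds[OF assms(1,2)] this]
  then show "bags n k w \<in> samples s (pool n k w) (num_bags_n n k)" "pool n k w \<subseteq> Pow {..<n}"
    using nte[OF assms(1)] by auto
qed

lemma bag_subset:
  assumes "n \<ge> 2" "k \<in> grid_n n" "w \<in> space A" "l < num_bags_n n k"
  shows "bags n k w l \<subseteq> {..<n}"
  using samples_in[OF bags_in_samples(1)[OF assms(1-3)] assms(4)] bags_in_samples(2)[OF assms(1-3)]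
  by auto

lemma z_measurable:
  assumes "i < n"
  shows "(\<lambda>\<omega>. z n \<omega> i) \<in> D \<rightarrow>\<^sub>M obs_space (p n)"
  using z_indep[of n] assms unfolding M1.indep_vars_def by auto

lemma
  assumes "n \<ge> 1"
  shows sets_P: "sets (P n) = sets (obs_space (p n))"
    and prob_space_P: "prob_space (P n)"
  using z_law[of 0 n] z_measurable[of 0 n] assms
  by (auto simp flip: z_law[of 0 n] intro!: M1.prob_space_distr)

text \<open>
  The base procedure is measurable in the product space over the index set of the subsample, so the
  data are first restricted to these indices, which does not change the dataset.
\<close>

lemma residual_measurable_pair:
  assumes n: "n \<ge> 1" and I: "I \<subseteq> {..<n}"
  shows "(\<lambda>(\<omega>, v). residual (fhat (p n)) (z n \<omega>) I v) \<in> borel_measurable (D \<Otimes>\<^sub>M P n)"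
proof -
  have fin: "finite I"
    using I by (rule finite_subset) simp
  have [measurable_cong]: "sets (P n) = sets (feature_space (p n) \<Otimes>\<^sub>M borel)"
    using sets_P[OF n] by (simp add: obs_space_def)
  have d: "(\<lambda>u. \<lambda>i\<in>I. z n (fst u) i) \<in> D \<Otimes>\<^sub>M P n \<rightarrow>\<^sub>M PiM I (\<lambda>_. obs_space (p n))"
    using I by (intro measurable_restrict measurable_compose[OF measurable_fst] z_measurable) auto
  have "(\<lambda>u. (fst (snd u), \<lambda>i\<in>I. z n (fst u) i))
      \<in> D \<Otimes>\<^sub>M P n \<rightarrow>\<^sub>M feature_space (p n) \<Otimes>\<^sub>M PiM I (\<lambda>_. obs_space (p n))"
    using d by measurable
  from measurable_compose[OF this fhat_measurable[OF fin]]
  have f: "(\<lambda>u. fhat (p n) (fst (snd u)) (subdata (\<lambda>i\<in>I. z n (fst u) i) I)) \<in> borel_measurable (D \<Otimes>\<^sub>M P n)"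
    by simp
  have "subdata (\<lambda>i\<in>I. z n \<omega> i) I = subdata (z n \<omega>) I" for \<omega>
    unfolding subdata_def using fin by (intro image_mset_cong) auto
  with f have [measurable]:
    "(\<lambda>u. fhat (p n) (fst (snd u)) (subdata (z n (fst u)) I)) \<in> borel_measurable (D \<Otimes>\<^sub>M P n)"
    by simp
  show ?thesis
    unfolding residual_def split_def by measurable
qed

lemma residual_measurable:
  assumes "n \<ge> 1" "I \<subseteq> {..<n}" "\<omega> \<in> space D"
  shows "residual (fhat (p n)) (z n \<omega>) I \<in> borel_measurable (P n)"
  using measurable_compose[OF measurable_Pair1'[OF assms(3)] residual_measurable_pair[OF assms(1,2)]]
  by simp

lemma sub_risk_measurable:
  assumes n: "n \<ge> 1" and m: "m \<ge> 1" and J: "\<And>l. l < m \<Longrightarrow> J l \<subseteq> {..<n}"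
  shows "(\<lambda>\<omega>. sub_risk (P n) (fhat (p n)) (z n \<omega>) m J) \<in> borel_measurable D"
proof -
  interpret Pn: prob_space "P n"
    by (rule prob_space_P[OF n])
  have "(\<lambda>u. residual (fhat (p n)) (z n (fst u)) (J l) (snd u)) \<in> borel_measurable (D \<Otimes>\<^sub>M P n)"
    if "l < m" for l
    using residual_measurable_pair[OF n J[OF that]] by (simp add: split_def)
  then have "(\<lambda>u. \<Sum>l<m. residual (fhat (p n)) (z n (fst u)) (J l) (snd u)) \<in> borel_measurable (D \<Otimes>\<^sub>M P n)"
    by (intro borel_measurable_sum) auto
  then show ?thesis
    unfolding sub_risk_eq_residual[OF m]
    by (intro measurable_compose[OF _ measurable_enn2ereal] Pn.borel_measurable_nn_integral)
      (simp add: split_def)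
qed

text \<open>
  The bags take values in a space of functions that is uncountable, but only finitely many of them;
  so the risk is glued from finitely many measurable pieces.
\<close>

lemma risk_measurable:
  assumes n: "n \<ge> 2" and K: "K \<in> D \<Otimes>\<^sub>M A \<rightarrow>\<^sub>M count_space UNIV"
    and K_grid: "\<And>v. v \<in> space (D \<Otimes>\<^sub>M A) \<Longrightarrow> K v \<in> grid_n n"
  shows "(\<lambda>v. risk n (K v) v) \<in> borel_measurable (D \<Otimes>\<^sub>M A)"
proof (rule measurable_compose_countable'[where I = "grid_n n"])
  show "countable (grid_n n)"
    using finite_grid[OF n] by (rule countable_finite)
  show "K \<in> D \<Otimes>\<^sub>M A \<rightarrow>\<^sub>M count_space (grid_n n)"
    using K K_grid by (auto simp: measurable_count_space_eq2[OF finite_grid[OF n]] intro: measurable_sets)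
  fix k assume k: "k \<in> grid_n n"
  let ?F = "{..<num_bags_n n k} \<rightarrow>\<^sub>E Pow {..<n}"
  have fin: "finite ?F"
    by (intro finite_PiE) auto
  have "bags n k w \<in> ?F" if "w \<in> space A" for w
    using subsetD[OF samples_subset bags_in_samples(1)[OF n k that]]
      PiE_mono[OF bags_in_samples(2)[OF n k that]] by blast
  then have "bags n k \<in> A \<rightarrow>\<^sub>M count_space ?F"
    unfolding measurable_count_space_eq2[OF fin]
    using measurable_sets[OF bags_measurable[OF n k]] by simp
  then have bags_F: "(\<lambda>v. bags n k (snd v)) \<in> D \<Otimes>\<^sub>M A \<rightarrow>\<^sub>M count_space ?F"
    by (rule measurable_compose[OF measurable_snd])
  have "(\<lambda>v. sub_risk (P n) (fhat (p n)) (z n (fst v)) (num_bags_n n k) (bags n k (snd v)))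
      \<in> borel_measurable (D \<Otimes>\<^sub>M A)"
  proof (rule measurable_compose_countable'[OF _ bags_F countable_finite[OF fin]])
    fix J assume J: "J \<in> ?F"
    have "J l \<subseteq> {..<n}" if "l < num_bags_n n k" for l
      using PiE_mem[OF J, of l] that by simp
    then show "(\<lambda>v. sub_risk (P n) (fhat (p n)) (z n (fst v)) (num_bags_n n k) J)
        \<in> borel_measurable (D \<Otimes>\<^sub>M A)"
      using n num_bags_pos[OF n k]
      by (intro measurable_compose[OF measurable_fst sub_risk_measurable]) linarith+
  qed
  then show "risk n k \<in> borel_measurable (D \<Otimes>\<^sub>M A)"
    by (simp add: risk_def[abs_def])
qed

section \<open>The risk along a fixed sequence of subsample sizes\<close>

lemma limit_num_bags_pos:
  assumes "\<phi> \<le> \<psi>"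
  shows "1 \<le> limit_num_bags s M (ereal \<phi>) (ereal \<psi>)"
proof -
  have "1 \<le> \<psi> / \<phi>"
    using assms phi_pos by simp
  then have "1 \<le> nat \<lfloor>\<psi> / \<phi>\<rfloor>"
    by (simp add: le_nat_floor)
  then show ?thesis
    using M_pos by (auto simp: limit_num_bags_def)
qed

text \<open>
  In general the risk converges by \<open>sub_risk_bagged_limit\<close>.  If there is only one bag in the
  limit, or if \<open>\<psi> = \<phi>\<close>, then the limiting risk is \<open>R \<psi> \<psi>\<close>, and Jensen's inequality bounds the
  risk instead.  For \<open>\<psi> = \<phi>\<close> this avoids the number of bags, which need not stabilise: the
  subsamples may be as large as the training set, and then there is only one of them.
\<close>

lemma risk_eventually_less:
  assumes psi: "\<phi> \<le> \<psi>"
    and less: "bagged_limit_risk R (limit_num_bags s M (ereal \<phi>) (ereal \<psi>)) (ereal \<phi>) (ereal \<psi>) < ereal \<rho>"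
  obtains k where "\<forall>\<^sub>F n in sequentially. k n \<in> grid_n n"
    "AE v in D \<Otimes>\<^sub>M A. \<forall>\<^sub>F n in sequentially. risk n (k n) v < ereal \<rho>"
proof -
  define L where "L = limit_num_bags s M (ereal \<phi>) (ereal \<psi>)"
  have L: "1 \<le> L"
    unfolding L_def by (rule limit_num_bags_pos[OF psi])
  obtain k where k_grid: "\<forall>\<^sub>F n in sequentially. k n \<in> grid_n n"
    and k_top: "filterlim k at_top sequentially"
    and k_aspect: "(\<lambda>n. real (p n) / real (k n)) \<longlonglongrightarrow> \<psi>"
    and k_le: "\<forall>\<^sub>F n in sequentially. real (k n) * \<psi> \<le> real (n - nte n) * \<phi>"
    and k_ratio: "(\<lambda>n. real (n - nte n) / real (k n)) \<longlonglongrightarrow> \<psi> / \<phi>"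
    by (rule ex_grid_sequence[OF nu phi_pos psi aspect _ nte_small]) (use nte in blast)
  have good: "\<forall>\<^sub>F n in sequentially. n \<ge> 2 \<and> k n \<in> grid_n n"
    using k_grid eventually_ge_at_top[of 2] by eventually_elim simp
  define m where "m n = num_bags_n n (k n)" for n
  have "0 \<le> R (ereal \<phi>) (ereal \<psi>)" "0 \<le> R (ereal \<psi>) (ereal \<psi>)"
    using phi_pos psi by (auto intro!: R_nonneg)
  moreover from this have "R (ereal \<phi>) (ereal \<psi>) \<noteq> \<infinity>" "R (ereal \<psi>) (ereal \<psi>) \<noteq> \<infinity>"
    using less bagged_limit_risk_infinite[of L R "ereal \<phi>" "ereal \<psi>"] L by (auto simp: L_def)
  ultimately obtain x y where xy: "R (ereal \<phi>) (ereal \<psi>) = ereal x" "R (ereal \<psi>) (ereal \<psi>) = ereal y"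
    by (cases "R (ereal \<phi>) (ereal \<psi>)"; cases "R (ereal \<psi>) (ereal \<psi>)") auto
  have less': "(2 * x - y) + 2 / real L * (y - x) < \<rho>"
    using less bagged_limit_risk_finite[of R "ereal \<phi>" "ereal \<psi>" x y L] xy by (simp add: L_def)

  \<comment> \<open>The index is cut off at the number of bags, beyond which \<open>bags n (k n) w\<close> is undefined.\<close>
  have "AE v in D \<Otimes>\<^sub>M A. (\<lambda>n. sub_risk (P n) (fhat (p n)) (z n (fst v)) 1
      (\<lambda>_. bags n (k n) (snd v) (min l (m n - 1)))) \<longlonglongrightarrow> ereal y" for l
    unfolding xy(2)[symmetric]
  proof (rule conv1[OF psi k_grid k_top k_aspect])
    show "\<forall>\<^sub>F n in sequentially.
        (\<lambda>w. bags n (k n) w (min l (m n - 1))) \<in> A \<rightarrow>\<^sub>M count_space UNIV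
        \<and> (\<forall>w\<in>space A. bags n (k n) w (min l (m n - 1)) \<in> pool n (k n) w)"
      using good
    proof eventually_elim
      case (elim n)
      then have l: "min l (m n - 1) < num_bags_n n (k n)"
        using num_bags_pos[of n "k n"] by (auto simp: m_def)
      have "bags n (k n) w (min l (m n - 1)) \<in> pool n (k n) w" if "w \<in> space A" for w
        using samples_in[OF bags_in_samples(1) l] elim that by blast
      then show ?case
        using measurable_compose[OF bags_measurable[of n "k n"], of "\<lambda>J. J (min l (m n - 1))"] elim
        by auto
    qed
  qed
  then have one: "AE v in D \<Otimes>\<^sub>M A. \<forall>l. (\<lambda>n. sub_risk (P n) (fhat (p n)) (z n (fst v)) 1
      (\<lambda>_. bags n (k n) (snd v) (min l (m n - 1)))) \<longlonglongrightarrow> ereal y"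
    by (simp add: AE_all_countable)

  have "AE v in D \<Otimes>\<^sub>M A. \<forall>\<^sub>F n in sequentially. risk n (k n) v < ereal \<rho>"
  proof (cases "L = 1 \<or> \<phi> = \<psi>")
    case True
    then have "y < \<rho>"
      using less' xy by auto
    then obtain \<rho>' where \<rho>': "y < \<rho>'" "\<rho>' < \<rho>"
      using dense by blast
    from one AE_space show ?thesis
    proof eventually_elim
      case (elim v)
      then have v: "fst v \<in> space D" "snd v \<in> space A"
        by (auto simp: space_pair_measure)
      have "\<forall>\<^sub>F n in sequentially. \<forall>l\<in>{..<M}. sub_risk (P n) (fhat (p n)) (z n (fst v)) 1
          (\<lambda>_. bags n (k n) (snd v) (min l (m n - 1))) < ereal \<rho>'"
        using elim(1) \<rho>'(1) by (intro eventually_ball_finite ballI order_tendstoD(2)) auto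
      with good show ?case
      proof eventually_elim
        case (elim n)
        have "risk n (k n) v \<le> ereal \<rho>'"
          unfolding risk_def
        proof (rule sub_risk_le_single_risks)
          show "1 \<le> num_bags_n n (k n)"
            using elim(1) num_bags_pos by simp
          fix l assume l: "l < num_bags_n n (k n)"
          then show "residual (fhat (p n)) (z n (fst v)) (bags n (k n) (snd v) l) \<in> borel_measurable (P n)"
            using elim(1) v by (intro residual_measurable bag_subset) auto
          have "min l (m n - 1) = l" "l < M"
            using l num_bags_le[of n "k n"] by (auto simp: m_def)
          then show "sub_risk (P n) (fhat (p n)) (z n (fst v)) 1 (\<lambda>_. bags n (k n) (snd v) l) \<le> ereal \<rho>'"
            using bspec[OF elim(2), of l] by simp
        qed
        then show ?case
          using \<rho>'(2) by (auto intro: order.strict_trans1)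
      qed
    qed
  next
    case False
    then have L2: "2 \<le> L" and psi': "\<phi> < \<psi>"
      using L psi by auto
    have num: "\<forall>\<^sub>F n in sequentially. num_bags s (n - nte n) (k n) M' =
        limit_num_bags s M' (ereal \<phi>) (ereal \<psi>)" for M'
      by (rule eventually_num_bags_eq_limit[OF phi_pos psi psi' k_top k_le k_ratio])
    have m: "\<forall>\<^sub>F n in sequentially. m n = L"
      using num[of M] by (simp add: m_def L_def)
    have "limit_num_bags s 2 (ereal \<phi>) (ereal \<psi>) = 2"
      using L2 by (auto simp: L_def limit_num_bags_def split: if_splits)
    then have two_bags: "\<forall>\<^sub>F n in sequentially. num_bags s (n - nte n) (k n) 2 = 2"
      using num[of 2] by simp
    have "AE v in D \<Otimes>\<^sub>M A. l < L \<and> j < L \<and> l \<noteq> j \<longrightarrow>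
        (\<lambda>n. sub_risk (P n) (fhat (p n)) (z n (fst v)) 2 (bag_pair l j (bags n (k n) (snd v)))) \<longlonglongrightarrow> ereal x"
      for l j
    proof (cases "l < L \<and> j < L \<and> l \<noteq> j")
      case lj: True
      have "AE v in D \<Otimes>\<^sub>M A.
          (\<lambda>n. sub_risk (P n) (fhat (p n)) (z n (fst v)) 2 (bag_pair l j (bags n (k n) (snd v)))) \<longlonglongrightarrow> ereal x"
        unfolding xy(1)[symmetric]
      proof (rule conv2[OF psi k_grid k_top k_aspect])
        show "\<forall>\<^sub>F n in sequentially. num_bags s (n - nte n) (k n) 2 = 2
          \<and> has_law A (\<lambda>w. (Ste n w, pool n (k n) w, bag_pair l j (bags n (k n) w)))
              (bags_law s n (nte n) (k n) 2)"
          using good two_bags m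
        proof eventually_elim
          case (elim n)
          have "map_pmf (\<lambda>(S, Q, J). (S, Q, bag_pair l j J)) (bags_law s n (nte n) (k n) M)
              = bags_law s n (nte n) (k n) 2"
            using elim lj grid_bounds[of n "k n"] nte[of n]
            by (intro bags_law_pair) (auto simp: m_def)
          then show ?case
            using elim(2) has_law_map[OF bags[of n "k n"], of "\<lambda>(S, Q, J). (S, Q, bag_pair l j J)"] elim(1)
            by simp
        qed
      qed
      then show ?thesis
        by simp
    qed auto
    then have "AE v in D \<Otimes>\<^sub>M A. \<forall>l j. l < L \<and> j < L \<and> l \<noteq> j \<longrightarrow>
        (\<lambda>n. sub_risk (P n) (fhat (p n)) (z n (fst v)) 2 (bag_pair l j (bags n (k n) (snd v)))) \<longlonglongrightarrow> ereal x"
      by (simp only: AE_all_countable) simp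
    with one AE_space show ?thesis
    proof eventually_elim
      case (elim v)
      then have v: "fst v \<in> space D" "snd v \<in> space A"
        by (auto simp: space_pair_measure)
      have "(\<lambda>n. sub_risk (P n) (fhat (p n)) (z n (fst v)) L (bags n (k n) (snd v)))
          \<longlonglongrightarrow> ereal ((2 * x - y) + 2 / real L * (y - x))"
      proof (rule sub_risk_bagged_limit[OF L2])
        show "\<forall>\<^sub>F n in sequentially. \<forall>l<L.
            residual (fhat (p n)) (z n (fst v)) (bags n (k n) (snd v) l) \<in> borel_measurable (P n)"
          using good m
        proof eventually_elim
          case (elim n)
          then show ?case
            using v bag_subset[of n "k n" "snd v"] by (auto simp: m_def intro!: residual_measurable)
        qed
        show "(\<lambda>n. sub_risk (P n) (fhat (p n)) (z n (fst v)) 1 (\<lambda>_. bags n (k n) (snd v) l)) \<longlonglongrightarrow> ereal y"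
          if "l < L" for l
        proof (rule Lim_transform_eventually[OF spec[OF elim(1), of l]])
          show "\<forall>\<^sub>F n in sequentially.
              sub_risk (P n) (fhat (p n)) (z n (fst v)) 1 (\<lambda>_. bags n (k n) (snd v) (min l (m n - 1)))
            = sub_risk (P n) (fhat (p n)) (z n (fst v)) 1 (\<lambda>_. bags n (k n) (snd v) l)"
            using m
          proof eventually_elim
            case (elim n)
            then have "min l (m n - 1) = l"
              using that by simp
            then show ?case
              by simp
          qed
        qed
      qed (use elim in auto)
      then have "\<forall>\<^sub>F n in sequentially.
          sub_risk (P n) (fhat (p n)) (z n (fst v)) L (bags n (k n) (snd v)) < ereal \<rho>"
        using less' by (intro order_tendstoD(2)) auto
      with m show ?case
        by eventually_elim (simp add: risk_def m_def)
    qed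
  qed
  with k_grid show thesis
    by (rule that)
qed

text \<open>
  The formula for the limiting risk has a negative coefficient, but a negative value would be
  an eventual upper bound of nonnegative risks.
\<close>

lemma bagged_limit_risk_nonneg:
  assumes "\<phi> \<le> \<psi>"
  shows "0 \<le> bagged_limit_risk R (limit_num_bags s M (ereal \<phi>) (ereal \<psi>)) (ereal \<phi>) (ereal \<psi>)"
proof (rule ccontr)
  assume "\<not> ?thesis"
  then have "bagged_limit_risk R (limit_num_bags s M (ereal \<phi>) (ereal \<psi>)) (ereal \<phi>) (ereal \<psi>) < ereal 0"
    by (simp add: zero_ereal_def)
  then obtain k where "AE v in D \<Otimes>\<^sub>M A. \<forall>\<^sub>F n in sequentially. risk n (k n) v < ereal 0"
    using risk_eventually_less[OF assms] by blast
  then have "AE v in D \<Otimes>\<^sub>M A. False"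
  proof eventually_elim
    case (elim v)
    then obtain n where "risk n (k n) v < 0"
      by (auto simp: eventually_sequentially zero_ereal_def)
    then show False
      using sub_risk_nonneg by (metis risk_def not_le)
  qed
  then show False
    using P.AE_False by simp
qed

end

section \<open>Transfer from the estimated to the conditional risk\<close>

lemma additive_error_transfer:
  fixes r r' :: ereal
  assumes "\<bar>ereal e - r\<bar> \<le> ereal \<delta>" "\<bar>ereal e' - r'\<bar> \<le> ereal \<delta>" "e \<le> e'" "r' < ereal \<rho>"
  shows "r \<le> ereal (\<rho> + 2 * \<delta>)"
  using assms by (cases r; cases r') auto

text \<open>
  A ratio close to 1 forces the risk to be positive and finite, because \<open>e / \<infinity> = 0\<close>, and \<open>e / 0\<close>
  is \<open>0\<close> or infinite, in \<^typ>\<open>ereal\<close>.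
\<close>

lemma ratio_error_bounds:
  assumes "\<bar>ereal e / r - 1\<bar> \<le> ereal \<delta>" "\<delta> < 1" "0 \<le> r"
  obtains x where "r = ereal x" "0 < x" "(1 - \<delta>) * x \<le> e" "e \<le> (1 + \<delta>) * x"
proof (cases r)
  case (real x)
  have "x \<noteq> 0"
  proof
    assume x: "x = 0"
    show False
      using assms real x by (cases "e = 0"; cases "e > 0") (auto simp: divide_ereal_def zero_ereal_def[symmetric] one_ereal_def)
  qed
  then have x: "0 < x"
    using real assms(3) by simp
  have "\<bar>e / x - 1\<bar> \<le> \<delta>"
    using assms(1) real x by (simp add: one_ereal_def)
  then have "1 - \<delta> \<le> e / x" "e / x \<le> 1 + \<delta>"
    by auto
  then show thesis
    using that[OF real x] x by (simp add: le_divide_eq divide_le_eq)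
next
  case PInf
  then show thesis
    using assms by (simp add: one_ereal_def zero_ereal_def[symmetric])
qed (use assms in auto)

lemma ratio_error_transfer:
  fixes r r' :: ereal
  assumes "\<bar>ereal e / r - 1\<bar> \<le> ereal \<delta>" "\<bar>ereal e' / r' - 1\<bar> \<le> ereal \<delta>" "\<delta> < 1" "0 \<le> \<delta>"
    and "0 \<le> r" "0 \<le> r'" "e \<le> e'" "r' < ereal \<rho>"
  shows "r \<le> ereal ((1 + \<delta>) / (1 - \<delta>) * \<rho>)"
proof -
  obtain x where x: "r = ereal x" "0 < x" "(1 - \<delta>) * x \<le> e"
    using ratio_error_bounds[OF assms(1,3,5)] .
  obtain x' where x': "r' = ereal x'" "0 < x'" "e' \<le> (1 + \<delta>) * x'"
    using ratio_error_bounds[OF assms(2,3,6)] .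
  have "(1 - \<delta>) * x \<le> (1 + \<delta>) * x'"
    using x x' assms by linarith
  also have "\<dots> \<le> (1 + \<delta>) * \<rho>"
    using x' assms by (intro mult_left_mono) auto
  finally have "x \<le> (1 + \<delta>) * \<rho> / (1 - \<delta>)"
    using assms by (simp add: le_divide_eq mult.commute)
  then show ?thesis
    by (simp add: x)
qed

lemma (in prob_space) prob_tendsto_0_of_AE_eventually:
  assumes "\<forall>\<^sub>F n in sequentially. B n \<in> events" "AE v in M. \<forall>\<^sub>F n in sequentially. v \<notin> B n"
  shows "(\<lambda>n. prob (B n)) \<longlonglongrightarrow> 0"
proof -
  define C where "C n = (if B n \<in> events then B n else {})" for n
  have C: "C n \<in> events" for n
    by (simp add: C_def)
  have "(\<lambda>n. \<integral>v. indicator (C n) v \<partial>M) \<longlonglongrightarrow> (\<integral>v. 0 \<partial>M :: real)"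
  proof (rule integral_dominated_convergence[where w = "\<lambda>_. 1"])
    show "AE v in M. (\<lambda>n. indicator (C n) v) \<longlonglongrightarrow> (0 :: real)"
      using assms(2)
    proof eventually_elim
      case (elim v)
      then have "\<forall>\<^sub>F n in sequentially. indicator (C n) v = (0 :: real)"
        by eventually_elim (simp add: C_def)
      then show ?case
        by (rule tendsto_eventually)
    qed
  qed (use C in \<open>auto split: split_indicator\<close>)
  then have "(\<lambda>n. prob (C n)) \<longlonglongrightarrow> 0"
    using C by (simp add: sets.sets_into_space Int_absorb2)
  moreover have "\<forall>\<^sub>F n in sequentially. prob (C n) = prob (B n)"
    using assms(1) by eventually_elim (simp add: C_def)
  ultimately show ?thesis
    by (rule Lim_transform_eventually)
qed

lemma conv0_in_prob_exceptional_sets: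
  assumes "conv0_in_prob N X" "\<delta> > 0"
  shows "\<forall>\<^sub>F n in sequentially. {v \<in> space N. \<bar>X n v\<bar> > ereal \<delta>} \<in> sets N"
    and "(\<lambda>n. measure N {v \<in> space N. \<bar>X n v\<bar> > ereal \<delta>}) \<longlonglongrightarrow> 0"
proof -
  have "\<forall>\<^sub>F n in sequentially. X n \<in> borel_measurable N"
    using assms by (simp add: conv0_in_prob_def)
  then show "\<forall>\<^sub>F n in sequentially. {v \<in> space N. \<bar>X n v\<bar> > ereal \<delta>} \<in> sets N"
  proof eventually_elim
    case (elim n)
    then show ?case
      by measurable
  qed
  show "(\<lambda>n. measure N {v \<in> space N. \<bar>X n v\<bar> > ereal \<delta>}) \<longlonglongrightarrow> 0"
    using assms by (simp add: conv0_in_prob_def)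
qed

lemma pos_diff_greater:
  assumes "\<bar>pos_diff a (ereal b)\<bar> > ereal \<epsilon>" "\<epsilon> > 0"
  shows "a > ereal (b + \<epsilon>)"
  using assms by (cases a) (auto simp: pos_diff_def split: if_splits)

lemma abs_Max_less_imp:
  fixes g :: "nat \<Rightarrow> ereal"
  assumes "finite G" "k \<in> G" "\<not> \<bar>MAX k\<in>G. g k\<bar> > ereal \<delta>"
  shows "g k \<le> ereal \<delta>"
proof -
  have "g k \<le> (MAX k\<in>G. g k)"
    using assms by (intro Max_ge) auto
  also have "\<dots> \<le> \<bar>MAX k\<in>G. g k\<bar>"
    by (cases "MAX k\<in>G. g k") auto
  finally show ?thesis
    using assms(3) by (simp add: not_less)
qed

context subsample_bagging
begin

text \<open>
  With either mode of closeness, the selected subsample size inherits, up to an arbitrarily small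
  loss, any upper bound on the risk that holds for one sequence of subsample sizes.
\<close>

lemma ex_closeness_transfer:
  fixes E :: "nat \<Rightarrow> nat \<Rightarrow> 'a \<times> 'b \<Rightarrow> real"
  assumes close: "conv0_in_prob (D \<Otimes>\<^sub>M A) (\<lambda>n v. MAX k\<in>grid_n n. \<bar>ereal (E n k v) - risk n k v\<bar>)
      \<or> conv0_in_prob (D \<Otimes>\<^sub>M A) (\<lambda>n v. MAX k\<in>grid_n n. \<bar>ereal (E n k v) / risk n k v - 1\<bar>)"
    and rho: "0 < \<rho>" "\<rho> < \<rho>'"
  obtains B where "\<forall>\<^sub>F n in sequentially. B n \<in> sets (D \<Otimes>\<^sub>M A)"
    "(\<lambda>n. measure (D \<Otimes>\<^sub>M A) (B n)) \<longlonglongrightarrow> 0"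
    "\<And>n v k k'. n \<ge> 2 \<Longrightarrow> v \<in> space (D \<Otimes>\<^sub>M A) \<Longrightarrow> v \<notin> B n \<Longrightarrow> k \<in> grid_n n \<Longrightarrow> k' \<in> grid_n n \<Longrightarrow>
        E n k v \<le> E n k' v \<Longrightarrow> risk n k' v < ereal \<rho> \<Longrightarrow> risk n k v \<le> ereal \<rho>'"
  using close
proof
  let ?X = "\<lambda>n v. MAX k\<in>grid_n n. \<bar>ereal (E n k v) - risk n k v\<bar>"
  assume X: "conv0_in_prob (D \<Otimes>\<^sub>M A) ?X"
  define \<delta> where "\<delta> = (\<rho>' - \<rho>) / 2"
  have \<delta>_eq: "\<rho> + 2 * \<delta> = \<rho>'"
    by (simp add: \<delta>_def field_simps)
  note B = conv0_in_prob_exceptional_sets[OF X, of \<delta>]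
  show thesis
  proof (rule that[OF B])
    show "\<delta> > 0" "\<delta> > 0"
      using rho \<delta>_def by simp_all
    fix n v k k' assume n: "n \<ge> 2" and v: "v \<in> space (D \<Otimes>\<^sub>M A)" "v \<notin> {v \<in> space (D \<Otimes>\<^sub>M A). \<bar>?X n v\<bar> > ereal \<delta>}"
      and k: "k \<in> grid_n n" "k' \<in> grid_n n" "E n k v \<le> E n k' v" "risk n k' v < ereal \<rho>"
    have "\<not> \<bar>?X n v\<bar> > ereal \<delta>"
      using v by blast
    note * = abs_Max_less_imp[OF finite_grid[OF n] _ this]
    show "risk n k v \<le> ereal \<rho>'"
      using additive_error_transfer[OF *[OF k(1)] *[OF k(2)] k(3,4)] by (simp add: \<delta>_eq)
  qed
next
  let ?X = "\<lambda>n v. MAX k\<in>grid_n n. \<bar>ereal (E n k v) / risk n k v - 1\<bar>"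
  assume X: "conv0_in_prob (D \<Otimes>\<^sub>M A) ?X"
  \<comment> \<open>This solves \<open>(1 + \<delta>) / (1 - \<delta>) = \<rho>' / \<rho>\<close>.\<close>
  define \<delta> where "\<delta> = (\<rho>' - \<rho>) / (\<rho>' + \<rho>)"
  have \<delta>: "0 < \<delta>" "\<delta> < 1"
    using rho by (auto simp: \<delta>_def)
  have "1 + \<delta> = 2 * \<rho>' / (\<rho>' + \<rho>)" "1 - \<delta> = 2 * \<rho> / (\<rho>' + \<rho>)"
    using rho by (auto simp: \<delta>_def field_simps)
  then have \<delta>_eq: "(1 + \<delta>) / (1 - \<delta>) * \<rho> = \<rho>'"
    using rho by simp
  note B = conv0_in_prob_exceptional_sets[OF X, of \<delta>]
  show thesis
  proof (rule that[OF B])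
    show "\<delta> > 0" "\<delta> > 0"
      using \<delta>(1) by simp_all
    fix n v k k' assume n: "n \<ge> 2" and v: "v \<in> space (D \<Otimes>\<^sub>M A)" "v \<notin> {v \<in> space (D \<Otimes>\<^sub>M A). \<bar>?X n v\<bar> > ereal \<delta>}"
      and k: "k \<in> grid_n n" "k' \<in> grid_n n" "E n k v \<le> E n k' v" "risk n k' v < ereal \<rho>"
    have "\<not> \<bar>?X n v\<bar> > ereal \<delta>"
      using v by blast
    note * = abs_Max_less_imp[OF finite_grid[OF n] _ this]
    have "0 \<le> risk n k v" "0 \<le> risk n k' v"
      by (simp_all add: risk_def)
    then show "risk n k v \<le> ereal \<rho>'"
      using ratio_error_transfer[OF *[OF k(1)] *[OF k(2)] \<delta>(2) _ _ _ k(3,4)] \<delta> unfolding \<delta>_eq by simp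
  qed
qed

text \<open>
  For given \<open>\<epsilon>\<close>, the competitor is taken for some \<open>\<psi>\<close> whose limiting risk is within \<open>\<epsilon> / 2\<close>
  of the infimum; the estimation error uses up the other half.
\<close>

lemma cross_validated_risk_optimal:
  fixes E :: "nat \<Rightarrow> nat \<Rightarrow> 'a \<times> 'b \<Rightarrow> real"
  assumes khat_measurable: "\<And>n. khat n \<in> (D \<Otimes>\<^sub>M A) \<rightarrow>\<^sub>M count_space UNIV"
    and khat: "\<And>n v. n \<ge> 2 \<Longrightarrow> grid_n n \<noteq> {} \<Longrightarrow> v \<in> space (D \<Otimes>\<^sub>M A) \<Longrightarrow>
        is_arg_min (\<lambda>k. E n k v) (\<lambda>k. k \<in> grid_n n) (khat n v)"
    and close: "conv0_in_prob (D \<Otimes>\<^sub>M A) (\<lambda>n v. MAX k\<in>grid_n n. \<bar>ereal (E n k v) - risk n k v\<bar>)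
      \<or> conv0_in_prob (D \<Otimes>\<^sub>M A) (\<lambda>n v. MAX k\<in>grid_n n. \<bar>ereal (E n k v) / risk n k v - 1\<bar>)"
  shows "conv0_in_prob (D \<Otimes>\<^sub>M A)
    (\<lambda>n v. pos_diff (risk n (khat n v) v) (opt_limit_risk s R M {ereal \<phi>..<\<infinity>} (ereal \<phi>)))"
proof -
  let ?N = "D \<Otimes>\<^sub>M A"
  let ?opt = "opt_limit_risk s R M {ereal \<phi>..<\<infinity>} (ereal \<phi>)"
  let ?R = "\<lambda>\<psi>. bagged_limit_risk R (limit_num_bags s M (ereal \<phi>) \<psi>) (ereal \<phi>) \<psi>"
  obtain k0 where "\<forall>\<^sub>F n in sequentially. k0 n \<in> grid_n n"
    by (rule ex_grid_sequence[OF nu phi_pos order_refl aspect _ nte_small]) (use nte in blast)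
  then have good: "\<forall>\<^sub>F n in sequentially. n \<ge> 2 \<and> grid_n n \<noteq> {}"
    using eventually_ge_at_top[of 2] by eventually_elim auto
  have khat_grid: "khat n v \<in> grid_n n" and khat_min: "\<And>k. k \<in> grid_n n \<Longrightarrow> E n (khat n v) v \<le> E n k v"
    if "n \<ge> 2" "grid_n n \<noteq> {}" "v \<in> space ?N" for n v
    using khat[OF that] by (auto simp: is_arg_min_linorder)
  have risk_khat: "(\<lambda>v. risk n (khat n v) v) \<in> borel_measurable ?N" if "n \<ge> 2" "grid_n n \<noteq> {}" for n
    using that by (intro risk_measurable khat_measurable khat_grid)
  have R_nonneg': "0 \<le> ?R \<psi>" if "\<psi> \<in> {ereal \<phi>..<\<infinity>}" for \<psi>
    using that bagged_limit_risk_nonneg by (cases \<psi>) auto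
  have opt_nonneg: "0 \<le> ?opt"
    unfolding opt_limit_risk_def by (intro INF_greatest R_nonneg')
  show ?thesis
    unfolding conv0_in_prob_def
  proof (intro conjI allI impI)
    show "\<forall>\<^sub>F n in sequentially. (\<lambda>v. pos_diff (risk n (khat n v) v) ?opt) \<in> borel_measurable ?N"
      using good
    proof eventually_elim
      case (elim n)
      then have [measurable]: "(\<lambda>v. risk n (khat n v) v) \<in> borel_measurable ?N"
        by (intro risk_khat) auto
      show ?case
        unfolding pos_diff_def by measurable
    qed
    fix \<epsilon> :: real assume \<epsilon>: "\<epsilon> > 0"
    let ?B = "\<lambda>n. {v \<in> space ?N. \<bar>pos_diff (risk n (khat n v) v) ?opt\<bar> > ereal \<epsilon>}"
    show "(\<lambda>n. measure ?N (?B n)) \<longlonglongrightarrow> 0"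
    proof (cases ?opt)
      case PInf
      then have "pos_diff a ?opt = 0" for a
        by (simp add: pos_diff_def)
      then show ?thesis
        using \<epsilon> by simp
    next
      case MInf
      then show ?thesis
        using opt_nonneg by simp
    next
      case (real b)
      have b: "0 \<le> b"
        using opt_nonneg real by simp
      have "?opt < ereal (b + \<epsilon> / 2)"
        using real \<epsilon> by simp
      then obtain \<psi> where "\<psi> \<in> {ereal \<phi>..<\<infinity>}" "?R \<psi> < ereal (b + \<epsilon> / 2)"
        unfolding opt_limit_risk_def INF_less_iff by blast
      then obtain \<psi>' where "\<phi> \<le> \<psi>'" "?R (ereal \<psi>') < ereal (b + \<epsilon> / 2)"
        by (cases \<psi>) auto
      then obtain k where k_grid: "\<forall>\<^sub>F n in sequentially. k n \<in> grid_n n"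
        and k_risk: "AE v in ?N. \<forall>\<^sub>F n in sequentially. risk n (k n) v < ereal (b + \<epsilon> / 2)"
        by (rule risk_eventually_less)
      have "0 < b + \<epsilon> / 2" "b + \<epsilon> / 2 < b + \<epsilon>"
        using b \<epsilon> by auto
      then obtain C where C: "\<forall>\<^sub>F n in sequentially. C n \<in> sets ?N" "(\<lambda>n. measure ?N (C n)) \<longlonglongrightarrow> 0"
        and transfer: "\<And>n v k k'. n \<ge> 2 \<Longrightarrow> v \<in> space ?N \<Longrightarrow> v \<notin> C n \<Longrightarrow> k \<in> grid_n n \<Longrightarrow>
          k' \<in> grid_n n \<Longrightarrow> E n k v \<le> E n k' v \<Longrightarrow> risk n k' v < ereal (b + \<epsilon> / 2) \<Longrightarrow>
          risk n k v \<le> ereal (b + \<epsilon>)"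
        using ex_closeness_transfer[OF close] by blast
      let ?C' = "\<lambda>n. {v \<in> space ?N. \<not> risk n (k n) v < ereal (b + \<epsilon> / 2)}"
      have C'_sets: "\<forall>\<^sub>F n in sequentially. ?C' n \<in> sets ?N"
        using k_grid good
      proof eventually_elim
        case (elim n)
        then have [measurable]: "risk n (k n) \<in> borel_measurable ?N"
          using risk_measurable[of n "\<lambda>_. k n"] by simp
        show ?case
          by measurable
      qed
      have "(\<lambda>n. measure ?N (?C' n)) \<longlonglongrightarrow> 0"
      proof (rule P.prob_tendsto_0_of_AE_eventually[OF C'_sets])
        show "AE v in ?N. \<forall>\<^sub>F n in sequentially. v \<notin> ?C' n"
          using k_risk by eventually_elim (auto elim: eventually_mono)
      qed
      from tendsto_add[OF this C(2)] have lim: "(\<lambda>n. measure ?N (?C' n) + measure ?N (C n)) \<longlonglongrightarrow> 0"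
        by simp
      have bound: "\<forall>\<^sub>F n in sequentially. measure ?N (?B n) \<le> measure ?N (?C' n) + measure ?N (C n)"
        using k_grid good C(1) C'_sets
      proof eventually_elim
        case (elim n)
        have "?B n \<subseteq> ?C' n \<union> C n"
        proof
          fix v assume v: "v \<in> ?B n"
          then have large: "risk n (khat n v) v > ereal (b + \<epsilon>)" and v': "v \<in> space ?N"
            using \<epsilon> pos_diff_greater[where b = b and \<epsilon> = \<epsilon>] by (simp_all add: real)
          have "\<not> risk n (k n) v < ereal (b + \<epsilon> / 2)" if "v \<notin> C n"
            using transfer[OF _ v' that, of "khat n v" "k n"] khat_grid[OF _ _ v'] khat_min[OF _ _ v']
              elim(1,2) large leD by blast
          then show "v \<in> ?C' n \<union> C n"
            using v' by blast
        qed
        then have "measure ?N (?B n) \<le> measure ?N (?C' n \<union> C n)"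
          using elim by (intro P.finite_measure_mono) auto
        also have "\<dots> \<le> measure ?N (?C' n) + measure ?N (C n)"
          using elim by (intro measure_Un_le) auto
        finally show ?case .
      qed
      show ?thesis
        by (rule tendsto_sandwich[OF _ bound tendsto_const lim]) simp
    qed
  qed
qed

end

section \<open>The deterministic assertions\<close>

text \<open>
  Along \<open>\<psi> = n * \<phi>\<close> the number of bags is eventually \<open>M\<close>, also for splagging, and the limiting
  risks converge to the one at \<open>\<infinity>\<close>, unless the latter is infinite.
\<close>

lemma opt_limit_risk_at_infinity:
  fixes \<phi> :: real
  assumes phi: "0 < \<phi>"
    and nonneg: "\<And>a b. 0 < a \<Longrightarrow> 0 < b \<Longrightarrow> 0 \<le> R a b"
    and M: "M \<ge> 1"
    and c1: "continuous (at \<infinity> within {ereal \<phi>..}) (\<lambda>\<psi>. R \<psi> \<psi>)"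
    and c2: "continuous (at \<infinity> within {ereal \<phi>..}) (R (ereal \<phi>))"
  shows "opt_limit_risk s R M {ereal \<phi>..} (ereal \<phi>) = opt_limit_risk s R M {ereal \<phi>..<\<infinity>} (ereal \<phi>)"
proof (rule antisym)
  let ?R = "\<lambda>\<psi>. bagged_limit_risk R (limit_num_bags s M (ereal \<phi>) \<psi>) (ereal \<phi>) \<psi>"
  let ?opt = "opt_limit_risk s R M {ereal \<phi>..<\<infinity>} (ereal \<phi>)"
  show "opt_limit_risk s R M {ereal \<phi>..} (ereal \<phi>) \<le> ?opt"
    unfolding opt_limit_risk_def by (intro INF_superset_mono) auto
  have "?opt \<le> ?R \<infinity>"
  proof (cases "R (ereal \<phi>) \<infinity> = \<infinity> \<or> R \<infinity> \<infinity> = \<infinity>")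
    case True
    then have "?R \<infinity> = \<infinity>"
      using M phi nonneg[of "ereal \<phi>" \<infinity>] nonneg[of \<infinity> \<infinity>]
      by (intro bagged_limit_risk_infinite) (auto simp: limit_num_bags_def)
    then show ?thesis
      by simp
  next
    case False
    then obtain x y where xy: "R (ereal \<phi>) \<infinity> = ereal x" "R \<infinity> \<infinity> = ereal y"
      using phi nonneg[of "ereal \<phi>" \<infinity>] nonneg[of \<infinity> \<infinity>]
      by (cases "R (ereal \<phi>) \<infinity>"; cases "R \<infinity> \<infinity>") auto
    define \<psi> where "\<psi> n = ereal (real n * \<phi>)" for n
    have lim: "filterlim \<psi> (at \<infinity> within {ereal \<phi>..}) sequentially"
      unfolding filterlim_at
    proof
      show "\<forall>\<^sub>F n in sequentially. \<psi> n \<in> {ereal \<phi>..} \<and> \<psi> n \<noteq> \<infinity>"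
        using phi by (intro eventually_sequentiallyI[of 1]) (simp add: \<psi>_def)
      have "filterlim (\<lambda>n. real n * \<phi>) at_top sequentially"
        using phi by (intro filterlim_at_top_mult_tendsto_pos[OF tendsto_const] filterlim_real_sequentially)
      then show "\<psi> \<longlonglongrightarrow> \<infinity>"
        unfolding \<psi>_def by (simp add: tendsto_PInfty_eq_at_top)
    qed
    have "(\<lambda>n. R (\<psi> n) (\<psi> n)) \<longlonglongrightarrow> ereal y" "(\<lambda>n. R (ereal \<phi>) (\<psi> n)) \<longlonglongrightarrow> ereal x"
      using filterlim_compose[OF c1[unfolded continuous_within] lim]
        filterlim_compose[OF c2[unfolded continuous_within] lim] xy by auto
    then have "(\<lambda>n. bagged_limit_risk R M (ereal \<phi>) (\<psi> n))
        \<longlonglongrightarrow> (2 * ereal x - ereal y) + ereal (2 / real M) * (ereal y - ereal x)"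
      unfolding bagged_limit_risk_def
      by (intro tendsto_add_ereal_general tendsto_diff_ereal_general tendsto_cmult_ereal) auto
    then have "(\<lambda>n. bagged_limit_risk R M (ereal \<phi>) (\<psi> n)) \<longlonglongrightarrow> ?R \<infinity>"
      by (simp add: bagged_limit_risk_def xy limit_num_bags_def)
    moreover have "\<forall>\<^sub>F n in sequentially. ?opt \<le> bagged_limit_risk R M (ereal \<phi>) (\<psi> n)"
      using eventually_ge_at_top[of M]
    proof eventually_elim
      case (elim n)
      have "limit_num_bags s M (ereal \<phi>) (\<psi> n) = M"
        using elim phi by (simp add: limit_num_bags_def \<psi>_def)
      moreover have "\<psi> n \<in> {ereal \<phi>..<\<infinity>}"
        using elim phi M by (simp add: \<psi>_def)
      ultimately show ?case
        unfolding opt_limit_risk_def by (intro INF_lower2[of "\<psi> n"]) auto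
    qed
    ultimately show ?thesis
      by (intro tendsto_lowerbound) auto
  qed
  moreover have "?opt \<le> ?R \<psi>" if "ereal \<phi> \<le> \<psi>" "\<psi> \<noteq> \<infinity>" for \<psi>
    unfolding opt_limit_risk_def using that by (intro INF_lower) auto
  ultimately show "?opt \<le> opt_limit_risk s R M {ereal \<phi>..} (ereal \<phi>)"
    unfolding opt_limit_risk_def[of s R M "{ereal \<phi>..}"]
    by (intro INF_greatest) (metis atLeast_iff)
qed

text \<open>
  The limiting risk increases with \<open>R \<phi> \<psi>\<close>, and it decreases with the number of bags as
  \<open>R \<phi> \<psi> \<le> R \<psi> \<psi>\<close>.  For larger \<open>\<phi>\<close> there are not more bags.
\<close>

lemma bagged_limit_risk_mono:
  assumes mono: "mono_on {0<..\<psi>} (\<lambda>\<phi>'. R \<phi>' \<psi>)"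
    and nonneg: "\<And>a b. 0 < a \<Longrightarrow> 0 < b \<Longrightarrow> 0 \<le> R a b"
    and le: "0 < a" "a \<le> b" "b \<le> \<psi>"
    and m: "1 \<le> m'" "m' \<le> m"
  shows "bagged_limit_risk R m a \<psi> \<le> bagged_limit_risk R m' b \<psi>"
proof (cases "R b \<psi> = \<infinity> \<or> R \<psi> \<psi> = \<infinity>")
  case True
  then have "bagged_limit_risk R m' b \<psi> = \<infinity>"
    using le m nonneg by (intro bagged_limit_risk_infinite) auto
  then show ?thesis
    by simp
next
  case False
  have Rab: "R a \<psi> \<le> R b \<psi>" "R b \<psi> \<le> R \<psi> \<psi>"
    using le by (auto intro!: mono_onD[OF mono])
  moreover have "0 \<le> R a \<psi>"
    using le by (auto intro: nonneg)
  ultimately obtain x x' y where xy: "R a \<psi> = ereal x" "R b \<psi> = ereal x'" "R \<psi> \<psi> = ereal y"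
    using False by (cases "R a \<psi>"; cases "R b \<psi>"; cases "R \<psi> \<psi>") auto
  have le': "x \<le> x'" "x' \<le> y"
    using Rab xy by auto
  have "2 / real m \<le> 2 / real m'" "2 / real m \<le> 2"
    using m by (auto simp: field_simps)
  then have "(2 - 2 / real m) * x \<le> (2 - 2 / real m) * x'"
    "2 / real m * (y - x') \<le> 2 / real m' * (y - x')"
    using le' by (simp_all only: mult_left_mono mult_right_mono diff_ge_0_iff_ge)
  moreover have "(2 * x - y) + A * (y - x) \<le> (2 * x' - y) + B * (y - x')"
    if "(2 - A) * x \<le> (2 - A) * x'" "A * (y - x') \<le> B * (y - x')" for A B :: real
    using that by (simp add: algebra_simps)
  ultimately have "(2 * x - y) + 2 / real m * (y - x) \<le> (2 * x' - y) + 2 / real m' * (y - x')"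
    by blast
  then show ?thesis
    unfolding bagged_limit_risk_finite[of R a \<psi> x y m, OF xy(1,3)] bagged_limit_risk_finite[of R b \<psi> x' y m', OF xy(2,3)]
    by simp
qed

lemma opt_limit_risk_mono:
  assumes mono: "\<And>\<psi>. 0 < \<psi> \<Longrightarrow> \<psi> < \<infinity> \<Longrightarrow> mono_on {0<..\<psi>} (\<lambda>\<phi>'. R \<phi>' \<psi>)"
    and nonneg: "\<And>a b. 0 < a \<Longrightarrow> 0 < b \<Longrightarrow> 0 \<le> R a b"
    and M: "1 \<le> M"
  shows "mono_on {0<..<\<infinity>} (\<lambda>\<phi>'. opt_limit_risk s R M {\<phi>'..<\<infinity>} \<phi>')"
proof (rule mono_onI)
  fix a b :: ereal assume ab: "a \<in> {0<..<\<infinity>}" "b \<in> {0<..<\<infinity>}" "a \<le> b"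
  show "opt_limit_risk s R M {a..<\<infinity>} a \<le> opt_limit_risk s R M {b..<\<infinity>} b"
    unfolding opt_limit_risk_def
  proof (rule INF_mono)
    fix \<psi> assume \<psi>: "\<psi> \<in> {b..<\<infinity>}"
    obtain a' b' \<psi>' where r: "a = ereal a'" "b = ereal b'" "\<psi> = ereal \<psi>'"
      using ab \<psi> by (cases a; cases b; cases \<psi>) auto
    have r': "0 < a'" "a' \<le> b'" "b' \<le> \<psi>'"
      using ab \<psi> r by auto
    have "1 \<le> \<psi>' / b'" "\<psi>' / b' \<le> \<psi>' / a'"
      using r' by (auto intro!: divide_left_mono)
    then have "1 \<le> nat \<lfloor>\<psi>' / b'\<rfloor>" "nat \<lfloor>\<psi>' / b'\<rfloor> \<le> nat \<lfloor>\<psi>' / a'\<rfloor>"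
      by (auto simp: le_nat_floor intro!: nat_mono floor_mono)
    then have "1 \<le> limit_num_bags s M b \<psi>" "limit_num_bags s M b \<psi> \<le> limit_num_bags s M a \<psi>"
      using M by (auto simp: limit_num_bags_def r)
    then have "bagged_limit_risk R (limit_num_bags s M a \<psi>) a \<psi> \<le> bagged_limit_risk R (limit_num_bags s M b \<psi>) b \<psi>"
      using ab \<psi> by (intro bagged_limit_risk_mono mono nonneg) auto
    then show "\<exists>\<psi>'\<in>{a..<\<infinity>}. bagged_limit_risk R (limit_num_bags s M a \<psi>') a \<psi>'
        \<le> bagged_limit_risk R (limit_num_bags s M b \<psi>) b \<psi>"
      using ab \<psi> by (intro bexI[of _ \<psi>]) auto
  qed
qed

section \<open>Risk monotonization by cross-validation\<close>

theorem theorem4p1: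
  fixes D :: "'a measure"  \<comment> \<open>randomness of the data\<close>
    and A :: "'b measure"  \<comment> \<open>randomness of the splitting and sampling, independent of the data\<close>
    and p nte :: "nat \<Rightarrow> nat"
    and P :: "nat \<Rightarrow> obs measure"
    and z :: "nat \<Rightarrow> 'a \<Rightarrow> nat \<Rightarrow> obs"
    and fhat :: "nat \<Rightarrow> procedure"
    and \<nu> \<phi> :: real
    and \<eta> :: "nat \<Rightarrow> real"
    and M :: nat
    and s :: sampling
    and c :: centering
    and Ste :: "nat \<Rightarrow> 'b \<Rightarrow> nat set"
    and blocks :: "nat \<Rightarrow> 'b \<Rightarrow> nat \<Rightarrow> nat set"
    and pool :: "nat \<Rightarrow> nat \<Rightarrow> 'b \<Rightarrow> nat set set"
    and bags :: "nat \<Rightarrow> nat \<Rightarrow> 'b \<Rightarrow> nat \<Rightarrow> nat set"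
    and khat :: "nat \<Rightarrow> 'a \<times> 'b \<Rightarrow> nat"
    and R :: "ereal \<Rightarrow> ereal \<Rightarrow> ereal"
  assumes prob: "prob_space D" "prob_space A"
    \<comment> \<open>asymptotic regime\<close>
    and phi_pos: "\<phi> > 0"
    and p_infinity: "filterlim p at_top sequentially"
    and aspect: "(\<lambda>n. real (p n) / real n) \<longlonglongrightarrow> \<phi>"
    \<comment> \<open>i.i.d. data and base procedure\<close>
    and z_indep: "\<And>n. prob_space.indep_vars D (\<lambda>_. obs_space (p n)) (\<lambda>i \<omega>. z n \<omega> i) {..<n}"
    and z_law: "\<And>n i. i < n \<Longrightarrow> distr D (obs_space (p n)) (\<lambda>\<omega>. z n \<omega> i) = P n"
    and fhat_measurable: "\<And>q I. finite I \<Longrightarrow>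
          (\<lambda>(x, d). fhat q x (subdata d I))
            \<in> borel_measurable (feature_space q \<Otimes>\<^sub>M PiM I (\<lambda>_. obs_space q))"
    \<comment> \<open>cross-validation procedure\<close>
    and M_pos: "M \<ge> 1"
    and nu: "0 < \<nu>" "\<nu> < 1"
    and nte: "\<And>n. n \<ge> 2 \<Longrightarrow> 0 < nte n \<and> nte n < n"
    and nte_small: "(\<lambda>n. real (nte n) / real n) \<longlonglongrightarrow> 0"
    and bags: "\<And>n k. n \<ge> 2 \<Longrightarrow> k \<in> grid \<nu> n (nte n) \<Longrightarrow>
          has_law A (\<lambda>w. (Ste n w, pool n k w, bags n k w)) (bags_law s n (nte n) k M)"
    and eta: "\<And>n. c = MOM \<Longrightarrow> 0 < \<eta> n \<and> \<eta> n < 1"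
    and blocks: "\<And>n. c = MOM \<Longrightarrow> n \<ge> 2 \<Longrightarrow>
          has_law A (\<lambda>w. (Ste n w, blocks n w)) (blocks_law n (nte n) (mom_blocks (\<eta> n)))"
    and khat_measurable: "\<And>n. khat n \<in> (D \<Otimes>\<^sub>M A) \<rightarrow>\<^sub>M count_space UNIV"
    and khat: "\<And>n \<omega> w. n \<ge> 2 \<Longrightarrow> grid \<nu> n (nte n) \<noteq> {} \<Longrightarrow> \<omega> \<in> space D \<Longrightarrow> w \<in> space A \<Longrightarrow>
          is_arg_min
            (\<lambda>k. est_risk c (mom_blocks (\<eta> n)) (z n \<omega>)
                   (bagged (fhat (p n)) (z n \<omega>) (num_bags s (n - nte n) k M) (bags n k w))
                   (Ste n w) (blocks n w))
            (\<lambda>k. k \<in> grid \<nu> n (nte n)) (khat n (\<omega>, w))"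
    \<comment> \<open>limiting risks: values and condition (i)\<close>
    and R_nonneg: "\<And>a b. 0 < a \<Longrightarrow> 0 < b \<Longrightarrow> 0 \<le> R a b"
    and conv1: "\<And>\<phi>s k I. \<phi> \<le> \<phi>s \<Longrightarrow>
          \<forall>\<^sub>F n in sequentially. k n \<in> grid \<nu> n (nte n) \<Longrightarrow>
          filterlim k at_top sequentially \<Longrightarrow>
          (\<lambda>n. real (p n) / real (k n)) \<longlonglongrightarrow> \<phi>s \<Longrightarrow>
          \<forall>\<^sub>F n in sequentially. I n \<in> A \<rightarrow>\<^sub>M count_space UNIV
             \<and> (\<forall>w\<in>space A. I n w \<in> pool n (k n) w) \<Longrightarrow>
          AE v in D \<Otimes>\<^sub>M A.
            (\<lambda>n. sub_risk (P n) (fhat (p n)) (z n (fst v)) 1 (\<lambda>_. I n (snd v)))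
              \<longlonglongrightarrow> R (ereal \<phi>s) (ereal \<phi>s)"
    and conv2: "\<And>\<phi>s k J. \<phi> \<le> \<phi>s \<Longrightarrow>
          \<forall>\<^sub>F n in sequentially. k n \<in> grid \<nu> n (nte n) \<Longrightarrow>
          filterlim k at_top sequentially \<Longrightarrow>
          (\<lambda>n. real (p n) / real (k n)) \<longlonglongrightarrow> \<phi>s \<Longrightarrow>
          \<forall>\<^sub>F n in sequentially. num_bags s (n - nte n) (k n) 2 = 2
             \<and> has_law A (\<lambda>w. (Ste n w, pool n (k n) w, J n w)) (bags_law s n (nte n) (k n) 2) \<Longrightarrow>
          AE v in D \<Otimes>\<^sub>M A.
            (\<lambda>n. sub_risk (P n) (fhat (p n)) (z n (fst v)) 2 (J n (snd v)))
              \<longlonglongrightarrow> R (ereal \<phi>) (ereal \<phi>s)"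
    \<comment> \<open>condition (ii)\<close>
    and proper: "\<And>\<phi>'::real. \<phi>' > 0 \<Longrightarrow> \<exists>\<psi>\<ge>ereal \<phi>'. R (ereal \<phi>') \<psi> \<noteq> \<infinity>"
    and lsc: "\<And>\<phi>'::real. \<phi>' > 0 \<Longrightarrow> lsc_on {ereal \<phi>'..} (R (ereal \<phi>'))"
    and cont_argmin: "\<And>(\<phi>'::real) \<psi>. \<phi>' > 0 \<Longrightarrow>
          is_arg_min (R (ereal \<phi>')) (\<lambda>\<psi>. \<psi> \<ge> ereal \<phi>') \<psi> \<Longrightarrow>
          continuous (at \<psi> within {ereal \<phi>'..}) (R (ereal \<phi>'))"
    \<comment> \<open>uniform closeness of the estimated risk\<close>
    and close:
      "conv0_in_prob (D \<Otimes>\<^sub>M A) (\<lambda>n (\<omega>, w). MAX k\<in>grid \<nu> n (nte n).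
          \<bar>ereal (est_risk c (mom_blocks (\<eta> n)) (z n \<omega>)
                   (bagged (fhat (p n)) (z n \<omega>) (num_bags s (n - nte n) k M) (bags n k w))
                   (Ste n w) (blocks n w))
           - sub_risk (P n) (fhat (p n)) (z n \<omega>) (num_bags s (n - nte n) k M) (bags n k w)\<bar>)
       \<or> conv0_in_prob (D \<Otimes>\<^sub>M A) (\<lambda>n (\<omega>, w). MAX k\<in>grid \<nu> n (nte n).
          \<bar>ereal (est_risk c (mom_blocks (\<eta> n)) (z n \<omega>)
                   (bagged (fhat (p n)) (z n \<omega>) (num_bags s (n - nte n) k M) (bags n k w))
                   (Ste n w) (blocks n w))
           / sub_risk (P n) (fhat (p n)) (z n \<omega>) (num_bags s (n - nte n) k M) (bags n k w)
           - 1\<bar>)"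
  shows
    "conv0_in_prob (D \<Otimes>\<^sub>M A) (\<lambda>n (\<omega>, w).
       pos_diff
         (sub_risk (P n) (fhat (p n)) (z n \<omega>)
            (num_bags s (n - nte n) (khat n (\<omega>, w)) M) (bags n (khat n (\<omega>, w)) w))
         (opt_limit_risk s R M {ereal \<phi>..<\<infinity>} (ereal \<phi>)))
     \<and> (continuous (at \<infinity> within {ereal \<phi>..}) (\<lambda>\<psi>. R \<psi> \<psi>)
          \<and> continuous (at \<infinity> within {ereal \<phi>..}) (R (ereal \<phi>))
        \<longrightarrow> opt_limit_risk s R M {ereal \<phi>..} (ereal \<phi>)
            = opt_limit_risk s R M {ereal \<phi>..<\<infinity>} (ereal \<phi>))
     \<and> ((\<forall>\<psi>\<in>{0<..<\<infinity>}. mono_on {0<..\<psi>} (\<lambda>\<phi>'. R \<phi>' \<psi>))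
        \<longrightarrow> (\<forall>s' M'. 1 \<le> M' \<longrightarrow>
              mono_on {0<..<\<infinity>} (\<lambda>\<phi>'. opt_limit_risk s' R M' {\<phi>'..<\<infinity>} \<phi>')))"
proof (intro conjI impI allI)
  interpret D: prob_space D
    by (rule prob)
  interpret A: prob_space A
    by (rule prob)
  interpret pair_prob_space D A ..
  interpret subsample_bagging D A p nte P z fhat \<nu> \<phi> M s Ste pool bags R
    using phi_pos aspect z_indep z_law fhat_measurable M_pos nu nte nte_small bags R_nonneg conv1 conv2
    by unfold_locales
  define E where "E n k v = est_risk c (mom_blocks (\<eta> n)) (z n (fst v))
      (bagged (fhat (p n)) (z n (fst v)) (num_bags s (n - nte n) k M) (bags n k (snd v)))
      (Ste n (snd v)) (blocks n (snd v))" for n k v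
  have "conv0_in_prob (D \<Otimes>\<^sub>M A) (\<lambda>n v. pos_diff (risk n (khat n v) v)
      (opt_limit_risk s R M {ereal \<phi>..<\<infinity>} (ereal \<phi>)))"
  proof (rule cross_validated_risk_optimal[where E = E])
    show "khat n \<in> (D \<Otimes>\<^sub>M A) \<rightarrow>\<^sub>M count_space UNIV" for n
      by (rule khat_measurable)
    show "is_arg_min (\<lambda>k. E n k v) (\<lambda>k. k \<in> grid \<nu> n (nte n)) (khat n v)"
      if "n \<ge> 2" "grid \<nu> n (nte n) \<noteq> {}" "v \<in> space (D \<Otimes>\<^sub>M A)" for n v
      using khat[OF that(1,2), of "fst v" "snd v"] that(3) unfolding E_def
      by (simp add: space_pair_measure mem_Times_iff)
    show "conv0_in_prob (D \<Otimes>\<^sub>M A) (\<lambda>n v. MAX k\<in>grid \<nu> n (nte n). \<bar>ereal (E n k v) - risk n k v\<bar>)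
      \<or> conv0_in_prob (D \<Otimes>\<^sub>M A) (\<lambda>n v. MAX k\<in>grid \<nu> n (nte n). \<bar>ereal (E n k v) / risk n k v - 1\<bar>)"
      using close unfolding E_def risk_def split_def .
  qed
  then show "conv0_in_prob (D \<Otimes>\<^sub>M A) (\<lambda>n (\<omega>, w).
       pos_diff
         (sub_risk (P n) (fhat (p n)) (z n \<omega>)
            (num_bags s (n - nte n) (khat n (\<omega>, w)) M) (bags n (khat n (\<omega>, w)) w))
         (opt_limit_risk s R M {ereal \<phi>..<\<infinity>} (ereal \<phi>)))"
    by (simp add: risk_def split_def)
next
  assume "continuous (at \<infinity> within {ereal \<phi>..}) (\<lambda>\<psi>. R \<psi> \<psi>)
    \<and> continuous (at \<infinity> within {ereal \<phi>..}) (R (ereal \<phi>))"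
  then show "opt_limit_risk s R M {ereal \<phi>..} (ereal \<phi>) = opt_limit_risk s R M {ereal \<phi>..<\<infinity>} (ereal \<phi>)"
    using phi_pos R_nonneg M_pos by (intro opt_limit_risk_at_infinity) auto
next
  fix s' M'
  assume "\<forall>\<psi>\<in>{0<..<\<infinity>}. mono_on {0<..\<psi>} (\<lambda>\<phi>'. R \<phi>' \<psi>)" "1 \<le> (M' :: nat)"
  then show "mono_on {0<..<\<infinity>} (\<lambda>\<phi>'. opt_limit_risk s' R M' {\<phi>'..<\<infinity>} \<phi>')"
    using R_nonneg by (intro opt_limit_risk_mono) auto
qed

end
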